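(* Let $B>0$, $c\in(0,\tfrac{1}{2B}]$, and let $\phi\in L^2(\mathbb{R})$ be such that $\mathcal{A}\phi(0,\omega)\neq0$ and $\mathcal{A}\phi(c,\omega)\neq0$ for almost every $\omega\in(-2B,2B)$. Then for all $f,g\in\mathrm{PW}^2_B$ the following are equivalent: (1) $f=e^{i\alpha}g$ for some $\alpha\in\mathbb{R}$; (2) $|\mathcal{V}_\phi f(x,\omega)|=|\mathcal{V}_\phi g(x,\omega)|$ for all $x,\omega\in\mathbb{R}$.
   Context: For $B>0$, the Paley--Wiener space is $\mathrm{PW}^2_B:=\{f:\mathbb{C}\to\mathbb{C} \mid \exists F\in L^2([-B,B])\ \forall z\in\mathbb{C}: f(z)=\int_{-B}^B F(\xi)e^{2\pi i \xi z}\,d\xi\}$; its elements are identified with their restrictions to $\mathbb{R}$ (which lie in $L^2(\mathbb{R})$) when transforms are applied. For $f,\phi\in L^2(\mathbb{R})$ the short-time Fourier transform is $\mathcal{V}_\phi f(x,\omega)=\int_{\mathbb{R}} f(t)\overline{\phi(t-x)}e^{-2\pi i t\omega}\,dt$, and the ambiguity function of $f\in L^2(\mathbb{R})$ is $\mathcal{A}f(x,\omega):=e^{\pi i x\omega}\mathcal{V}_f f(x,\omega)$, for $x,\omega\in\mathbb{R}$. *)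

theory Defs
  imports "HOL-Analysis.Analysis"
begin

text \<open>Square-integrable complex functions on the real line (elements of L^2(R),
  represented by functions; no quotient by null functions).\<close>
definition L2 :: "(real \<Rightarrow> complex) set" where
  "L2 = {f. f \<in> borel_measurable lborel \<and> integrable lborel (\<lambda>t. (norm (f t))\<^sup>2)}"

definition L2_on :: "real set \<Rightarrow> (real \<Rightarrow> complex) set" where
  "L2_on S = {F. set_borel_measurable lborel S F \<and> set_integrable lborel S (\<lambda>t. (norm (F t))\<^sup>2)}"

definition stft :: "(real \<Rightarrow> complex) \<Rightarrow> (real \<Rightarrow> complex) \<Rightarrow> real \<Rightarrow> real \<Rightarrow> complex" where
  "stft \<phi> f x \<omega> = (LINT t|lborel. f t * cnj (\<phi> (t - x)) * exp (- 2 * pi * \<i> * complex_of_real (t * \<omega>)))"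

definition ambiguity :: "(real \<Rightarrow> complex) \<Rightarrow> real \<Rightarrow> real \<Rightarrow> complex" where
  "ambiguity f x \<omega> = exp (pi * \<i> * complex_of_real (x * \<omega>)) * stft f f x \<omega>"

definition PW :: "real \<Rightarrow> (complex \<Rightarrow> complex) set" where
  "PW B = {f. \<exists>F \<in> L2_on {-B..B}. \<forall>z. f z =
      (LINT \<xi>:{-B..B}|lborel. F \<xi> * exp (2 * pi * \<i> * complex_of_real \<xi> * z))}"

definition restr :: "(complex \<Rightarrow> complex) \<Rightarrow> real \<Rightarrow> complex" where
  "restr f = (\<lambda>t. f (complex_of_real t))"

end

theory Submission
  imports Defs "HOL-Probability.Probability" "HOL-Complex_Analysis.Complex_Analysis"
    "HOL-Real_Asymp.Real_Asymp"
begin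

text \<open>The spectrogram determines the products of \<open>\<A>f\<close> with the conjugate of \<open>\<A>\<phi>\<close>, and
  \<open>\<A>f(q, \<cdot>)\<close> is up to a phase the Fourier transform of the autocorrelation \<open>f(t + q) cnj(f(t))\<close>, hence
  supported in \<open>[-2B, 2B]\<close>. So the hypotheses on \<open>\<phi>\<close> with \<open>q = 0\<close> and \<open>q = c\<close> show that
  \<open>\<bar>f\<bar> = \<bar>g\<bar>\<close> and \<open>f(t + c) cnj(f(t)) = g(t + c) cnj(g(t))\<close> on the real line. Choosing \<open>t\<close> such that the zeros of
  \<open>g\<close> avoid the lattice \<open>t + c\<int>\<close>, the quotient \<open>f/g\<close> is a constant of modulus 1 on this lattice, and
  since \<open>c \<le> 1/(2B)\<close> a function in the Paley--Wiener space is determined by its samples there.\<close>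

subsection \<open>Gaussian regularisation of the Fourier transform\<close>

text \<open>The hypotheses concern the two exact lags \<open>0\<close> and \<open>c\<close>, so an
  identity valid for almost every lag \<open>q\<close> would be useless. The products of
  autocorrelation transforms are therefore reached as Gaussian averages over \<open>q\<close>, in
  which every interchange of integrals is absolutely convergent, and continuity of
  \<open>corr f q \<omega>\<close> in \<open>q\<close> removes the averaging at each single lag.
  That continuity comes from continuity of translations in L2. In \<omega>, almost everywhere is
  enough, because the autocorrelations of Paley-Wiener functions are continuous, bounded and
  integrable. The bound 2B is the reach of the difference set of [-B, B], where an autocorrelation
  has its spectrum. The bound 1/(2B) rules out aliasing: for such \<open>c\<close> the map taking
  \<xi> to \<open>cis (2 * pi * c * \<xi>)\<close> is injective on (-B, B); at equality only the two
  end points collide, a null set. Lag 0 yields only moduli. Lag \<open>c\<close> adds the phase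
  difference of neighbouring samples, and a zero on the lattice would break this chain; this is why
  the lattice is shifted by a free \<open>t\<close>.\<close>

lemma borel_measurable_cis [measurable (raw)]:
  "f \<in> borel_measurable M \<Longrightarrow> (\<lambda>x. cis (f x)) \<in> borel_measurable M"
  by (rule borel_measurable_continuous_on[of cis]) (auto intro!: continuous_intros)

lemma borel_measurable_cnj [measurable (raw)]:
  "f \<in> borel_measurable M \<Longrightarrow> (\<lambda>x. cnj (f x)) \<in> borel_measurable M"
  by (rule borel_measurable_continuous_on[of cnj]) (auto intro!: continuous_intros)

lemma integrable_mult_bounded:
  fixes f g :: "'a \<Rightarrow> complex"
  assumes "integrable M f" "g \<in> borel_measurable M" "\<And>x. norm (g x) \<le> K"
  shows "integrable M (\<lambda>x. f x * g x)"
proof (rule Bochner_Integration.integrable_bound)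
  show "integrable M (\<lambda>x. K * norm (f x))" using assms(1) by simp
  show "(\<lambda>x. f x * g x) \<in> borel_measurable M" using assms by measurable
  show "AE x in M. norm (f x * g x) \<le> norm (K * norm (f x))"
    using assms(3) by (auto simp: norm_mult mult.commute[of K] intro!: AE_I2 mult_left_mono order_trans[OF _ abs_ge_self])
qed

lemma integrable_translate_iff:
  fixes f :: "real \<Rightarrow> 'a::{banach, second_countable_topology}"
  shows "integrable lborel (\<lambda>x. f (x + t)) \<longleftrightarrow> integrable lborel f"
  using lborel_integrable_real_affine_iff[of 1 f t] by (simp add: add.commute)

lemma integral_translate:
  fixes f :: "real \<Rightarrow> 'a::{banach, second_countable_topology}"
  shows "(LINT x|lborel. f (x + t)) = integral\<^sup>L lborel f"
  using lborel_integral_real_affine[of 1 f t] by (simp add: add.commute)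

lemma integrable_reflect_iff:
  fixes f :: "real \<Rightarrow> 'a::{banach, second_countable_topology}"
  shows "integrable lborel (\<lambda>x. f (t - x)) \<longleftrightarrow> integrable lborel f"
  using lborel_integrable_real_affine_iff[of "-1" f t] by simp

lemma integral_reflect:
  fixes f :: "real \<Rightarrow> 'a::{banach, second_countable_topology}"
  shows "(LINT x|lborel. f (t - x)) = integral\<^sup>L lborel f"
  using lborel_integral_real_affine[of "-1" f t] by simp

text \<open>Normalised so that its Fourier transform is the normal density with standard deviation
  \<open>e\<close>. As \<open>e\<close> tends to 0 the weight tends to 1 pointwise while its
  transform concentrates at 0 with total mass 1.\<close>

definition gauss :: "real \<Rightarrow> real \<Rightarrow> real" where
  "gauss e \<omega> = exp (- 2 * (pi * e * \<omega>)\<^sup>2)"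

lemma gauss_measurable [measurable]: "gauss e \<in> borel_measurable borel"
  unfolding gauss_def by measurable

lemma gauss_nonneg: "0 \<le> gauss e \<omega>" and gauss_le_1: "gauss e \<omega> \<le> 1"
  by (auto simp: gauss_def)

lemma gauss_eq_density:
  assumes "e > 0"
  shows "gauss e \<omega> = sqrt (2 * pi) * std_normal_density (2 * pi * e * \<omega>)"
  by (simp add: gauss_def std_normal_density_def power2_eq_square)

lemma integrable_gauss:
  assumes "e > 0" shows "integrable lborel (gauss e)"
proof -
  have "integrable lborel (\<lambda>x. std_normal_density (0 + (2 * pi * e) * x))"
    using assms by (intro lborel_integrable_real_affine) (auto simp: integrable_normal_density)
  then have "integrable lborel (\<lambda>x. sqrt (2 * pi) * std_normal_density (2 * pi * e * x))"
    by simp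
  then show ?thesis
    unfolding gauss_eq_density[OF assms, symmetric] by simp
qed

text \<open>After the scaling \<open>x = 2 * pi * e * \<omega>\<close> the integral is the
  characteristic function of the standard normal distribution at \<open>r / e\<close>.\<close>

lemma LINT_gauss_cis:
  assumes "e > 0"
  shows "(LINT \<omega>|lborel. complex_of_real (gauss e \<omega>) * cis (2 * pi * r * \<omega>)) = normal_density 0 e r"
proof -
  let ?f = "\<lambda>x. complex_of_real (std_normal_density x) * cis (r / e * x)"
  have "(LINT x|lborel. ?f x) = char std_normal_distribution (r / e)"
    unfolding char_def
    by (subst integral_density) (auto simp: cis_conv_exp scaleR_conv_of_real mult_ac)
  also have "\<dots> = exp (- ((r/e)\<^sup>2) / 2)"
    by (simp add: char_std_normal_distribution)
  finally have *: "(LINT x|lborel. ?f x) = exp (- ((r/e)\<^sup>2) / 2)" .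
  have "(LINT x|lborel. ?f x) = (2 * pi * e) *\<^sub>R (LINT x|lborel. ?f (0 + (2 * pi * e) * x))"
    using assms by (subst lborel_integral_real_affine[where c = "2 * pi * e" and t = 0]) auto
  also have "(LINT x|lborel. ?f (0 + (2 * pi * e) * x)) =
      (LINT \<omega>|lborel. complex_of_real (gauss e \<omega>) * cis (2 * pi * r * \<omega>) / sqrt (2 * pi))"
    using assms by (intro Bochner_Integration.integral_cong) (auto simp: gauss_eq_density mult_ac)
  also have "\<dots> = (LINT \<omega>|lborel. complex_of_real (gauss e \<omega>) * cis (2 * pi * r * \<omega>)) / sqrt (2 * pi)"
    by simp
  finally have "(LINT \<omega>|lborel. complex_of_real (gauss e \<omega>) * cis (2 * pi * r * \<omega>)) =
      complex_of_real (sqrt (2 * pi) / (2 * pi * e) * exp (- ((r/e)\<^sup>2) / 2))"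
    using assms * by (simp add: scaleR_conv_of_real field_simps)
  also have "sqrt (2 * pi) / (2 * pi * e) = 1 / sqrt (2 * pi * e\<^sup>2)"
    using assms by (simp add: real_sqrt_mult field_simps)
  finally show ?thesis
    by (simp add: normal_density_def power_divide)
qed

text \<open>Scaling \<open>r\<close> by the standard deviation moves the dependence on
  \<open>n\<close> into the argument of \<open>H\<close>. A fixed multiple of the standard normal
  density then dominates, and continuity at the point \<open>s\<close> gives the limit.\<close>

lemma approx_identity:
  fixes H :: "real \<Rightarrow> complex"
  assumes [measurable]: "H \<in> borel_measurable borel" and bd: "\<And>x. norm (H x) \<le> K"
    and cont: "isCont H s"
  shows "(\<lambda>n. LINT r|lborel. normal_density 0 (inverse (Suc n)) r * H (s + r)) \<longlonglongrightarrow> H s"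
proof -
  have eq: "(LINT r|lborel. normal_density 0 (inverse (Suc n)) r * H (s + r)) =
      (LINT y|lborel. std_normal_density y * H (s + inverse (Suc n) * y))" for n
  proof -
    let ?e = "inverse (real (Suc n))"
    have "(LINT r|lborel. normal_density 0 ?e r * H (s + r)) =
        ?e *\<^sub>R (LINT y|lborel. normal_density 0 ?e (0 + ?e * y) * H (s + (0 + ?e * y)))"
      by (subst lborel_integral_real_affine[where c = ?e and t = 0]) auto
    also have "\<dots> = (LINT y|lborel. (?e * normal_density 0 ?e (?e * y)) * H (s + ?e * y))"
      by (simp add: scaleR_conv_of_real flip: integral_mult_right_zero) (simp add: mult_ac)
    also have "(\<lambda>y. ?e * normal_density 0 ?e (?e * y)) = std_normal_density"
      by (rule ext, simp add: normal_density_def real_sqrt_mult power_mult_distrib del: of_nat_Suc)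
    finally show ?thesis .
  qed
  have "(\<lambda>n. LINT y|lborel. std_normal_density y * H (s + inverse (Suc n) * y))
      \<longlonglongrightarrow> (LINT y|lborel. std_normal_density y * H s)"
  proof (rule integral_dominated_convergence[where w = "\<lambda>y. K * std_normal_density y"])
    show "AE y in lborel. (\<lambda>n. complex_of_real (std_normal_density y) * H (s + inverse (Suc n) * y))
        \<longlonglongrightarrow> std_normal_density y * H s"
    proof (intro AE_I2 tendsto_intros)
      fix y
      have "(\<lambda>n. s + inverse (real (Suc n)) * y) \<longlonglongrightarrow> s + 0 * y"
        by (intro tendsto_intros LIMSEQ_inverse_real_of_nat)
      then show "(\<lambda>n. H (s + inverse (real (Suc n)) * y)) \<longlonglongrightarrow> H s"
        using isCont_tendsto_compose[OF cont] by simp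
    qed
    show "AE y in lborel. norm (complex_of_real (std_normal_density y) * H (s + inverse (real (Suc n)) * y)) \<le> K * std_normal_density y" for n
      using bd by (auto simp: norm_mult mult.commute[of K] intro!: mult_left_mono)
  qed (auto simp: integrable_normal_density)
  also have "(LINT y|lborel. std_normal_density y * H s) = H s"
    by (simp add: integral_normal_density)
  finally show ?thesis unfolding eq .
qed

lemma LIMSEQ_gauss: "(\<lambda>n. gauss (inverse (Suc n)) \<omega>) \<longlonglongrightarrow> 1"
proof -
  have "(\<lambda>n. exp (- 2 * (pi * inverse (real (Suc n)) * \<omega>)\<^sup>2)) \<longlonglongrightarrow> exp (- 2 * (pi * 0 * \<omega>)\<^sup>2)"
    by (intro tendsto_intros LIMSEQ_inverse_real_of_nat)
  then show ?thesis by (simp add: gauss_def)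
qed

section \<open>The Fourier transform and its Gaussian-weighted inversion\<close>

definition fourier :: "(real \<Rightarrow> complex) \<Rightarrow> real \<Rightarrow> complex" where
  "fourier u \<omega> = (LINT t|lborel. u t * cis (- (2 * pi * t * \<omega>)))"

lemma fourier_measurable [measurable]:
  assumes [measurable]: "u \<in> borel_measurable borel"
  shows "fourier u \<in> borel_measurable borel"
  unfolding fourier_def by measurable

lemma norm_fourier_le:
  assumes "integrable lborel u"
  shows "norm (fourier u \<omega>) \<le> (LINT t|lborel. norm (u t))"
  unfolding fourier_def using integral_norm_bound[of lborel "\<lambda>t. u t * cis (- (2 * pi * t * \<omega>))"]
  by (simp add: norm_mult)

lemma integrable_pair_mult:
  fixes f g :: "real \<Rightarrow> complex"
  assumes f: "integrable lborel f" and g: "integrable lborel g"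
    and [measurable]: "h \<in> borel_measurable (lborel \<Otimes>\<^sub>M lborel)" and h: "\<And>p. norm (h p) \<le> K"
  shows "integrable (lborel \<Otimes>\<^sub>M lborel) (\<lambda>(x, y). f x * g y * h (x, y))"
proof -
  have [measurable]: "f \<in> borel_measurable borel" "g \<in> borel_measurable borel"
    using borel_measurable_integrable[OF f] borel_measurable_integrable[OF g] by auto
  have "integrable (lborel \<Otimes>\<^sub>M lborel) (\<lambda>p. f (fst p) * g (snd p))"
    using f g by (intro lborel_pair.Fubini_integrable) (auto simp: norm_mult)
  from integrable_mult_bounded[OF this _ h] show ?thesis
    by (simp add: case_prod_beta')
qed

text \<open>Fourier inversion blurred by a Gaussian: the weight makes the double integral absolutely
  convergent for every integrable \<open>u\<close>, and the inner integral over \<omega> is the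
  normal density at \<open>s - t\<close>.\<close>

lemma fourier_gauss:
  assumes u: "integrable lborel u" and e: "e > 0"
  shows "(LINT \<omega>|lborel. fourier u \<omega> * gauss e \<omega> * cis (2 * pi * s * \<omega>)) =
         (LINT t|lborel. u t * normal_density 0 e (s - t))"
proof -
  have [measurable]: "u \<in> borel_measurable borel"
    using borel_measurable_integrable[OF u] by simp
  have g: "integrable lborel (\<lambda>\<omega>. complex_of_real (gauss e \<omega>))"
    using integrable_gauss[OF e] by simp
  have "(LINT \<omega>|lborel. fourier u \<omega> * gauss e \<omega> * cis (2 * pi * s * \<omega>)) =
     (LINT \<omega>|lborel. (LINT t|lborel. u t * gauss e \<omega> * (cis (- (2 * pi * t * \<omega>)) * cis (2 * pi * s * \<omega>))))"
    unfolding fourier_def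
    by (intro Bochner_Integration.integral_cong refl, subst integral_mult_left_zero[symmetric], subst integral_mult_left_zero[symmetric])
       (simp add: mult_ac)
  also have "\<dots> = (LINT t|lborel. (LINT \<omega>|lborel. u t * gauss e \<omega> * (cis (- (2 * pi * t * \<omega>)) * cis (2 * pi * s * \<omega>))))"
    using integrable_pair_mult[OF u g, of "\<lambda>(t, \<omega>). cis (- (2 * pi * t * \<omega>)) * cis (2 * pi * s * \<omega>)" 1]
    by (intro lborel_pair.Fubini_integral) (simp add: norm_mult split: prod.splits)
  also have "\<dots> = (LINT t|lborel. u t * normal_density 0 e (s - t))"
  proof (rule Bochner_Integration.integral_cong[OF refl])
    fix t
    have "cis (- (2 * pi * t * \<omega>)) * cis (2 * pi * s * \<omega>) = cis (2 * pi * (s - t) * \<omega>)" for \<omega>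
      unfolding cis_mult by (rule arg_cong[of _ _ cis]) (simp add: algebra_simps)
    then show "(LINT \<omega>|lborel. u t * gauss e \<omega> * (cis (- (2 * pi * t * \<omega>)) * cis (2 * pi * s * \<omega>))) =
        u t * normal_density 0 e (s - t)"
      using LINT_gauss_cis[OF e, of "s - t"] by (simp only: mult.assoc integral_mult_right_zero)
  qed
  finally show ?thesis .
qed

subsection \<open>Square-integrable functions\<close>

lemma L2_measurable: "f \<in> L2 \<Longrightarrow> f \<in> borel_measurable borel"
  by (simp add: L2_def)

lemma L2_integrable: "f \<in> L2 \<Longrightarrow> integrable lborel (\<lambda>t. (norm (f t))\<^sup>2)"
  by (simp add: L2_def)

lemma L2_translate: "f \<in> L2 \<Longrightarrow> (\<lambda>t. f (t + a)) \<in> L2"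
  using integrable_translate_iff[of "\<lambda>t. (norm (f t))\<^sup>2" a] by (auto simp: L2_def)

lemma L2_translate_diff: "f \<in> L2 \<Longrightarrow> (\<lambda>t. f (t - a)) \<in> L2"
  using L2_translate[of f "- a"] by simp

lemma L2_reflect: "f \<in> L2 \<Longrightarrow> (\<lambda>t. f (a - t)) \<in> L2"
  using integrable_reflect_iff[of "\<lambda>t. (norm (f t))\<^sup>2" a] by (auto simp: L2_def)

lemma L2_cnj: "f \<in> L2 \<Longrightarrow> (\<lambda>t. cnj (f t)) \<in> L2"
  using borel_measurable_cnj[of f borel] by (simp add: L2_def)

lemma L2_diff:
  assumes "f \<in> L2" "g \<in> L2" shows "(\<lambda>t. f t - g t) \<in> L2"
proof -
  note [measurable] = assms[THEN L2_measurable]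
  have "integrable lborel (\<lambda>t. 2 * ((norm (f t))\<^sup>2 + (norm (g t))\<^sup>2))"
    using assms[THEN L2_integrable] by auto
  then have "integrable lborel (\<lambda>t. (norm (f t - g t))\<^sup>2)"
  proof (rule Bochner_Integration.integrable_bound)
    have "(norm (a - b))\<^sup>2 \<le> 2 * ((norm a)\<^sup>2 + (norm b)\<^sup>2)" for a b :: complex
    proof -
      have "(norm (a - b))\<^sup>2 \<le> (norm a + norm b)\<^sup>2"
        by (intro power_mono norm_triangle_ineq4) auto
      also have "\<dots> \<le> 2 * ((norm a)\<^sup>2 + (norm b)\<^sup>2)"
        using zero_le_power2[of "norm a - norm b"] by (simp add: power2_eq_square algebra_simps)
      finally show ?thesis .
    qed
    then show "AE t in lborel. norm ((norm (f t - g t))\<^sup>2) \<le> norm (2 * ((norm (f t))\<^sup>2 + (norm (g t))\<^sup>2))"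
      by auto
  qed measurable
  then show ?thesis by (simp add: L2_def)
qed

lemma L2_mult_integrable:
  assumes "f \<in> L2" "g \<in> L2"
  shows "integrable lborel (\<lambda>t. f t * g t)"
proof -
  note [measurable] = assms[THEN L2_measurable]
  have "integrable lborel (\<lambda>t. (norm (f t))\<^sup>2 + (norm (g t))\<^sup>2)"
    using assms[THEN L2_integrable] by auto
  then show ?thesis
  proof (rule Bochner_Integration.integrable_bound)
    have "norm (a * b) \<le> (norm a)\<^sup>2 + (norm b)\<^sup>2" for a b :: complex
      using sum_squares_bound[of "norm a" "norm b"] mult_nonneg_nonneg[OF norm_ge_zero norm_ge_zero, of a b]
      unfolding norm_mult by linarith
    then show "AE t in lborel. norm (f t * g t) \<le> norm ((norm (f t))\<^sup>2 + (norm (g t))\<^sup>2)"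
      by auto
  qed measurable
qed

lemma L2_mult_cnj_integrable:
  "f \<in> L2 \<Longrightarrow> g \<in> L2 \<Longrightarrow> integrable lborel (\<lambda>t. f t * cnj (g t))"
  by (intro L2_mult_integrable L2_cnj)

text \<open>A weighted arithmetic-geometric inequality, from the square of
  \<open>\<delta> * norm (f t) - norm (g t)\<close>, in the role of Cauchy-Schwarz. The free
  \<delta> allows one factor to be made small against a fixed other one.\<close>

lemma LINT_norm_mult_le:
  assumes fg: "f \<in> L2" "g \<in> L2" and d: "\<delta> > 0"
  shows "(LINT t|lborel. norm (f t * g t)) \<le>
    \<delta> / 2 * (LINT t|lborel. (norm (f t))\<^sup>2) + 1 / (2 * \<delta>) * (LINT t|lborel. (norm (g t))\<^sup>2)"
proof -
  have "(LINT t|lborel. norm (f t * g t)) \<le>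
      (LINT t|lborel. \<delta> / 2 * (norm (f t))\<^sup>2 + 1 / (2 * \<delta>) * (norm (g t))\<^sup>2)"
  proof (intro integral_mono integrable_norm L2_mult_integrable fg)
    show "integrable lborel (\<lambda>t. \<delta> / 2 * (norm (f t))\<^sup>2 + 1 / (2 * \<delta>) * (norm (g t))\<^sup>2)"
      using fg[THEN L2_integrable] by auto
    show "norm (f t * g t) \<le> \<delta> / 2 * (norm (f t))\<^sup>2 + 1 / (2 * \<delta>) * (norm (g t))\<^sup>2" for t
      using d zero_le_power2[of "\<delta> * norm (f t) - norm (g t)"]
      by (simp add: norm_mult field_simps power2_eq_square)
  qed
  also have "\<dots> = \<delta> / 2 * (LINT t|lborel. (norm (f t))\<^sup>2) + 1 / (2 * \<delta>) * (LINT t|lborel. (norm (g t))\<^sup>2)"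
    using fg[THEN L2_integrable] by (subst Bochner_Integration.integral_add) auto
  finally show ?thesis .
qed

lemma norm_LINT_mult_le:
  assumes "f \<in> L2" "g \<in> L2" "\<delta> > 0"
  shows "norm (LINT t|lborel. f t * g t) \<le>
    \<delta> / 2 * (LINT t|lborel. (norm (f t))\<^sup>2) + 1 / (2 * \<delta>) * (LINT t|lborel. (norm (g t))\<^sup>2)"
  using LINT_norm_mult_le[OF assms] integral_norm_bound[of lborel "\<lambda>t. f t * g t"] by linarith

text \<open>A blurred Parseval identity: the right-hand side is the correlation of \<open>u\<close>
  with \<open>v\<close> near lag \<open>s\<close>. Only the integral defining
  \<open>fourier v\<close> is opened; \<open>fourier u\<close> stays as a bounded factor until
  Fubini has been applied, and \<open>fourier_gauss\<close> at the point \<open>s + t'\<close> then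
  resolves the inner integral.\<close>

lemma fourier_mult_gauss:
  assumes u: "integrable lborel u" and v: "integrable lborel v" and e: "e > 0"
  shows "(LINT \<omega>|lborel. fourier u \<omega> * cnj (fourier v \<omega>) * gauss e \<omega> * cis (2 * pi * s * \<omega>)) =
         (LINT t'|lborel. (LINT t|lborel. cnj (v t') * u t * normal_density 0 e (s + t' - t)))"
proof -
  have [measurable]: "u \<in> borel_measurable borel" "v \<in> borel_measurable borel"
    using borel_measurable_integrable[OF u] borel_measurable_integrable[OF v] by auto
  have g: "integrable lborel (\<lambda>\<omega>. complex_of_real (gauss e \<omega>))"
    using integrable_gauss[OF e] by simp
  define h where "h = (\<lambda>(t', \<omega>). fourier u \<omega> * (cis (2 * pi * t' * \<omega>) * cis (2 * pi * s * \<omega>)))"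
  have cj: "cnj (fourier v \<omega>) = (LINT t'|lborel. cnj (v t') * cis (2 * pi * t' * \<omega>))" for \<omega>
    unfolding fourier_def by (simp add: cis_cnj flip: Bochner_Integration.integral_cnj)
  have "integrable (lborel \<Otimes>\<^sub>M lborel) (\<lambda>(t', \<omega>). cnj (v t') * complex_of_real (gauss e \<omega>) * h (t', \<omega>))"
    using norm_fourier_le[OF u] v g
    by (intro integrable_pair_mult[where K = "LINT t|lborel. norm (u t)"]) (auto simp: h_def norm_mult split: prod.splits)
  then have int: "integrable (lborel \<Otimes>\<^sub>M lborel)
      (\<lambda>(t', \<omega>). cnj (v t') * (fourier u \<omega> * gauss e \<omega> * (cis (2 * pi * t' * \<omega>) * cis (2 * pi * s * \<omega>))))"
    by (simp add: h_def mult_ac)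
  have "(LINT \<omega>|lborel. fourier u \<omega> * cnj (fourier v \<omega>) * gauss e \<omega> * cis (2 * pi * s * \<omega>)) =
     (LINT \<omega>|lborel. (LINT t'|lborel. cnj (v t') * (fourier u \<omega> * gauss e \<omega> * (cis (2 * pi * t' * \<omega>) * cis (2 * pi * s * \<omega>)))))"
  proof (intro Bochner_Integration.integral_cong refl)
    fix \<omega>
    show "fourier u \<omega> * cnj (fourier v \<omega>) * gauss e \<omega> * cis (2 * pi * s * \<omega>) =
       (LINT t'|lborel. cnj (v t') * (fourier u \<omega> * gauss e \<omega> * (cis (2 * pi * t' * \<omega>) * cis (2 * pi * s * \<omega>))))"
      unfolding cj by (simp flip: integral_mult_left_zero integral_mult_right_zero) (simp add: mult_ac)
  qed
  also have "\<dots> = (LINT t'|lborel. (LINT \<omega>|lborel. cnj (v t') * (fourier u \<omega> * gauss e \<omega> * (cis (2 * pi * t' * \<omega>) * cis (2 * pi * s * \<omega>)))))"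
    by (rule lborel_pair.Fubini_integral[OF int])
  also have "\<dots> = (LINT t'|lborel. (LINT t|lborel. cnj (v t') * u t * normal_density 0 e (s + t' - t)))"
  proof (rule Bochner_Integration.integral_cong[OF refl])
    fix t'
    have "cis (2 * pi * t' * \<omega>) * cis (2 * pi * s * \<omega>) = cis (2 * pi * (s + t') * \<omega>)" for \<omega>
      unfolding cis_mult by (rule arg_cong[of _ _ cis]) (simp add: algebra_simps)
    then show "(LINT \<omega>|lborel. cnj (v t') * (fourier u \<omega> * gauss e \<omega> * (cis (2 * pi * t' * \<omega>) * cis (2 * pi * s * \<omega>)))) =
        (LINT t|lborel. cnj (v t') * u t * normal_density 0 e (s + t' - t))"
      using fourier_gauss[OF u e, of "s + t'"] by (simp only: mult.assoc integral_mult_right_zero)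
  qed
  finally show ?thesis .
qed

text \<open>Schur's test: a Gaussian kernel has total mass 1 in each variable.\<close>

lemma schur_gauss:
  fixes s :: real
  assumes f: "f \<in> L2" and e: "e > 0"
  defines "\<Psi> \<equiv> \<lambda>p :: real \<times> real. normal_density 0 e (s + fst p - snd p) * (norm (f (fst p)) * norm (f (snd p)))"
  shows "integrable (lborel \<Otimes>\<^sub>M lborel) \<Psi>"
    and "(LINT p|(lborel \<Otimes>\<^sub>M lborel). \<Psi> p) \<le> (LINT t|lborel. (norm (f t))\<^sup>2)"
proof -
  note [measurable] = f[THEN L2_measurable]
  let ?A = "\<lambda>p :: real \<times> real. normal_density 0 e (s + fst p - snd p) * (norm (f (fst p)))\<^sup>2"
  let ?B = "\<lambda>p :: real \<times> real. normal_density 0 e (s + fst p - snd p) * (norm (f (snd p)))\<^sup>2"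
  \<comment> \<open>\<open>?B'\<close> is \<open>?B\<close> with the coordinates exchanged: the
    integrability criterion integrates over the second coordinate first, and that has to be the one
    on which only the kernel depends.\<close>
  let ?B' = "\<lambda>p :: real \<times> real. normal_density 0 e (s + snd p - fst p) * (norm (f (fst p)))\<^sup>2"
  have i1: "integrable lborel (\<lambda>y. normal_density 0 e (a - y))" for a
    using e by (subst integrable_reflect_iff) simp
  have i2: "(LINT y|lborel. normal_density 0 e (a - y)) = 1" for a
    using e by (subst integral_reflect) simp
  have i3: "integrable lborel (\<lambda>y. normal_density 0 e (s + y - a))" for a
    using e integrable_translate_iff[of "normal_density 0 e" "s - a"] by (simp add: algebra_simps)
  have i4: "(LINT y|lborel. normal_density 0 e (s + y - a)) = 1" for a
    using e integral_translate[of "normal_density 0 e" "s - a"] by (simp add: algebra_simps)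
  have A: "integrable (lborel \<Otimes>\<^sub>M lborel) ?A"
    using f[THEN L2_integrable] i1 by (intro lborel_pair.Fubini_integrable) (auto simp: i2)
  have B': "integrable (lborel \<Otimes>\<^sub>M lborel) ?B'"
    using f[THEN L2_integrable] i3 by (intro lborel_pair.Fubini_integrable) (auto simp: i4)
  have B: "integrable (lborel \<Otimes>\<^sub>M lborel) ?B"
    using lborel_pair.integrable_product_swap[OF B'] by (simp add: case_prod_beta')
  have IA: "integral\<^sup>L (lborel \<Otimes>\<^sub>M lborel) ?A = (LINT t|lborel. (norm (f t))\<^sup>2)"
    by (subst lborel_pair.integral_fst'[OF A, symmetric]) (simp add: i2)
  have "integral\<^sup>L (lborel \<Otimes>\<^sub>M lborel) ?B = integral\<^sup>L (lborel \<Otimes>\<^sub>M lborel) ?B'"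
    using lborel_pair.integral_product_swap[of ?B'] by (simp add: case_prod_beta')
  also have "\<dots> = (LINT t|lborel. (norm (f t))\<^sup>2)"
    by (subst lborel_pair.integral_fst'[OF B', symmetric]) (simp add: i4)
  finally have IB: "integral\<^sup>L (lborel \<Otimes>\<^sub>M lborel) ?B = (LINT t|lborel. (norm (f t))\<^sup>2)" .
  have le: "\<Psi> p \<le> (?A p + ?B p) / 2" for p
  proof -
    have "norm (f (fst p)) * norm (f (snd p)) \<le> ((norm (f (fst p)))\<^sup>2 + (norm (f (snd p)))\<^sup>2) / 2"
      using sum_squares_bound[of "norm (f (fst p))" "norm (f (snd p))"] by simp
    from mult_left_mono[OF this, of "normal_density 0 e (s + fst p - snd p)"] show ?thesis
      by (simp add: \<Psi>_def distrib_left)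
  qed
  have AB: "integrable (lborel \<Otimes>\<^sub>M lborel) (\<lambda>p. (?A p + ?B p) / 2)"
    using A B by simp
  show \<Psi>: "integrable (lborel \<Otimes>\<^sub>M lborel) \<Psi>"
  proof (rule Bochner_Integration.integrable_bound[OF AB])
    show "\<Psi> \<in> borel_measurable (lborel \<Otimes>\<^sub>M lborel)" unfolding \<Psi>_def by measurable
    have "\<Psi> p \<ge> 0" for p by (simp add: \<Psi>_def)
    then show "AE p in lborel \<Otimes>\<^sub>M lborel. norm (\<Psi> p) \<le> norm ((?A p + ?B p) / 2)"
      using order_trans[OF le abs_ge_self] by (intro AE_I2) simp
  qed
  have "(LINT p|(lborel \<Otimes>\<^sub>M lborel). \<Psi> p) \<le> (LINT p|(lborel \<Otimes>\<^sub>M lborel). (?A p + ?B p) / 2)"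
    by (intro integral_mono \<Psi> AB le)
  also have "\<dots> = (LINT t|lborel. (norm (f t))\<^sup>2)"
    using A B by (simp add: IA IB)
  finally show "(LINT p|(lborel \<Otimes>\<^sub>M lborel). \<Psi> p) \<le> (LINT t|lborel. (norm (f t))\<^sup>2)" .
qed

text \<open>The blurred Parseval identity at \<open>s = 0\<close> with \<open>u = v = F\<close>
  turns the left side into the quadratic form that Schur's test bounds. The bound does not depend on
  \<open>e\<close>.\<close>

lemma LINT_fourier_gauss_le:
  assumes F: "F \<in> L2" "integrable lborel F" and e: "e > 0"
  shows "(LINT \<omega>|lborel. (norm (fourier F \<omega>))\<^sup>2 * gauss e \<omega>) \<le> (LINT t|lborel. (norm (F t))\<^sup>2)"
proof -
  note [measurable] = F(1)[THEN L2_measurable]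
  let ?\<Psi> = "\<lambda>p. cnj (F (fst p)) * F (snd p) * normal_density 0 e (0 + fst p - snd p)"
  have n: "norm (?\<Psi> p) = normal_density 0 e (0 + fst p - snd p) * (norm (F (fst p)) * norm (F (snd p)))" for p
    by (simp add: norm_mult)
  have I: "integrable (lborel \<Otimes>\<^sub>M lborel) ?\<Psi>"
    using schur_gauss(1)[OF F(1) e, of 0] unfolding n[symmetric] by (subst (asm) integrable_norm_iff) auto
  have "complex_of_real (LINT \<omega>|lborel. (norm (fourier F \<omega>))\<^sup>2 * gauss e \<omega>) =
      (LINT \<omega>|lborel. fourier F \<omega> * cnj (fourier F \<omega>) * gauss e \<omega> * cis (2 * pi * 0 * \<omega>))"
    by (subst integral_complex_of_real[symmetric]) (simp add: complex_norm_square del: of_real_power)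
  also have "\<dots> = (LINT p|(lborel \<Otimes>\<^sub>M lborel). ?\<Psi> p)"
    unfolding fourier_mult_gauss[OF F(2) F(2) e] lborel_pair.integral_fst'[OF I, symmetric] by simp
  finally have "\<bar>LINT \<omega>|lborel. (norm (fourier F \<omega>))\<^sup>2 * gauss e \<omega>\<bar> = norm (LINT p|(lborel \<Otimes>\<^sub>M lborel). ?\<Psi> p)"
    by (metis norm_of_real)
  also have "\<dots> \<le> (LINT p|(lborel \<Otimes>\<^sub>M lborel). norm (?\<Psi> p))"
    by (rule integral_norm_bound)
  also have "\<dots> \<le> (LINT t|lborel. (norm (F t))\<^sup>2)"
    unfolding n by (rule schur_gauss(2)[OF F(1) e])
  finally show ?thesis by simp
qed

text \<open>One half of Plancherel's theorem: the weights tend to 1, and Fatou's lemma carries the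
  uniform bound of \<open>LINT_fourier_gauss_le\<close> to the limit.\<close>

lemma fourier_L2:
  assumes F: "F \<in> L2" "integrable lborel F"
  shows "fourier F \<in> L2"
proof -
  note [measurable] = F(1)[THEN L2_measurable]
  let ?C = "LINT t|lborel. (norm (F t))\<^sup>2"
  let ?h = "\<lambda>n \<omega>. (norm (fourier F \<omega>))\<^sup>2 * gauss (inverse (real (Suc n))) \<omega>"
  have int: "integrable lborel (?h n)" for n
  proof -
    have bd: "(norm (fourier F \<omega>))\<^sup>2 \<le> (LINT t|lborel. norm (F t))\<^sup>2" for \<omega>
      by (intro power_mono norm_fourier_le F) auto
    have "integrable lborel (\<lambda>\<omega>. (LINT t|lborel. norm (F t))\<^sup>2 * gauss (inverse (real (Suc n))) \<omega>)"
      using integrable_gauss[of "inverse (real (Suc n))"] by simp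
    then show ?thesis
      by (rule Bochner_Integration.integrable_bound)
         (use bd gauss_nonneg in \<open>auto simp: abs_mult intro!: mult_mono AE_I2\<close>)
  qed
  have "(\<integral>\<^sup>+\<omega>. ennreal ((norm (fourier F \<omega>))\<^sup>2) \<partial>lborel) = (\<integral>\<^sup>+\<omega>. liminf (\<lambda>n. ennreal (?h n \<omega>)) \<partial>lborel)"
  proof (intro nn_integral_cong)
    fix \<omega>
    have "(\<lambda>n. ?h n \<omega>) \<longlonglongrightarrow> (norm (fourier F \<omega>))\<^sup>2 * 1"
      by (intro tendsto_intros LIMSEQ_gauss)
    then have "(\<lambda>n. ennreal (?h n \<omega>)) \<longlonglongrightarrow> ennreal ((norm (fourier F \<omega>))\<^sup>2)"
      by (simp add: tendsto_ennrealI)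
    then show "ennreal ((norm (fourier F \<omega>))\<^sup>2) = liminf (\<lambda>n. ennreal (?h n \<omega>))"
      by (simp add: lim_imp_Liminf)
  qed
  also have "\<dots> \<le> liminf (\<lambda>n. \<integral>\<^sup>+\<omega>. ennreal (?h n \<omega>) \<partial>lborel)"
    by (intro nn_integral_liminf) measurable
  also have "\<dots> \<le> liminf (\<lambda>n. ennreal ?C)"
  proof (intro Liminf_mono always_eventually allI)
    fix n
    have "(\<integral>\<^sup>+\<omega>. ennreal (?h n \<omega>) \<partial>lborel) = ennreal (LINT \<omega>|lborel. ?h n \<omega>)"
      using gauss_nonneg by (intro nn_integral_eq_integral int) auto
    also have "\<dots> \<le> ennreal ?C"
      by (intro ennreal_leI LINT_fourier_gauss_le F) auto
    finally show "(\<integral>\<^sup>+\<omega>. ennreal (?h n \<omega>) \<partial>lborel) \<le> ennreal ?C" .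
  qed
  also have "\<dots> < \<infinity>" by (simp add: Liminf_const)
  finally have "integrable lborel (\<lambda>\<omega>. (norm (fourier F \<omega>))\<^sup>2)"
    by (intro integrableI_bounded) auto
  then show ?thesis by (simp add: L2_def)
qed

subsection \<open>Continuity of translations\<close>

text \<open>Continuity of translation passes to L1 limits. The error between \<open>u\<close> and
  \<open>v\<close> enters twice, once translated, and translation invariance gives both the same
  size; hence the thirds of \<open>r\<close>.\<close>

lemma L1_translation_approx:
  fixes u :: "real \<Rightarrow> complex"
  assumes u: "integrable lborel u"
    and approx: "\<And>\<epsilon>. \<epsilon> > 0 \<Longrightarrow> \<exists>v. integrable lborel v \<and> (LINT t|lborel. norm (u t - v t)) \<le> \<epsilon> \<and>
        (\<lambda>n. LINT t|lborel. norm (v (t + X n) - v t)) \<longlonglongrightarrow> 0"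
  shows "(\<lambda>n. LINT t|lborel. norm (u (t + X n) - u t)) \<longlonglongrightarrow> 0"
proof (rule LIMSEQ_I)
  fix r :: real assume r: "r > 0"
  from approx[of "r / 3"] r obtain v where v: "integrable lborel v"
    and uv: "(LINT t|lborel. norm (u t - v t)) \<le> r / 3"
    and lim: "(\<lambda>n. LINT t|lborel. norm (v (t + X n) - v t)) \<longlonglongrightarrow> 0" by auto
  have d: "integrable lborel (\<lambda>t. norm (u t - v t))" using u v by auto
  from LIMSEQ_D[OF lim, of "r / 3"] r obtain N where
    N: "\<And>n. n \<ge> N \<Longrightarrow> \<bar>LINT t|lborel. norm (v (t + X n) - v t)\<bar> < r / 3" by auto
  have "norm ((LINT t|lborel. norm (u (t + X n) - u t)) - 0) < r" if "n \<ge> N" for n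
  proof -
    have d': "integrable lborel (\<lambda>t. norm (u (t + X n) - v (t + X n)))"
      using d integrable_translate_iff[of "\<lambda>t. norm (u t - v t)" "X n"] by simp
    have dv: "integrable lborel (\<lambda>t. norm (v (t + X n) - v t))"
      using v integrable_translate_iff[of v "X n"] by auto
    have "(LINT t|lborel. norm (u (t + X n) - u t)) \<le>
        (LINT t|lborel. norm (u (t + X n) - v (t + X n)) + norm (v (t + X n) - v t) + norm (u t - v t))"
    proof (rule integral_mono')
      fix t
      show "norm (u (t + X n) - u t) \<le>
          norm (u (t + X n) - v (t + X n)) + norm (v (t + X n) - v t) + norm (u t - v t)"
        by (smt (verit, ccfv_threshold) norm_diff_triangle_ineq norm_minus_commute norm_triangle_ineq2 add_diff_cancel diff_add_cancel norm_triangle_ineq4 norm_triangle_sub)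
    qed (use d d' dv in auto)
    also have "\<dots> = (LINT t|lborel. norm (u t - v t)) + (LINT t|lborel. norm (v (t + X n) - v t)) + (LINT t|lborel. norm (u t - v t))"
      using d d' dv integral_translate[of "\<lambda>t. norm (u t - v t)" "X n"] by simp
    finally have "(LINT t|lborel. norm (u (t + X n) - u t)) < r"
      using uv N[OF that] by linarith
    then show ?thesis by simp
  qed
  then show "\<exists>N. \<forall>n\<ge>N. norm ((LINT t|lborel. norm (u (t + X n) - u t)) - 0) < r" by blast
qed

text \<open>The absolute difference of an indicator \<open>b\<close> and its translate is
  \<open>2 * (b t * (1 - b (t + x))) + b (t + x) - b t\<close>, whose last two terms cancel after
  integration. What remains is dominated by \<open>b\<close> and vanishes eventually at each point,
  because \<open>U\<close> is open.\<close>

lemma L1_translation_open: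
  fixes U :: "real set" and c :: complex
  assumes U: "open U" "emeasure lborel U < \<infinity>" and X: "X \<longlonglongrightarrow> 0"
  shows "(\<lambda>n. LINT t|lborel. norm (indicator U (t + X n) *\<^sub>R c - indicator U t *\<^sub>R c)) \<longlonglongrightarrow> 0"
proof -
  define b where "b = (indicator U :: real \<Rightarrow> real)"
  have [measurable]: "b \<in> borel_measurable borel" using U by (auto simp: b_def)
  have b: "integrable lborel b" using U by (simp add: b_def)
  have b': "integrable lborel (\<lambda>t. b (t + x))" for x using b by (simp add: integrable_translate_iff)
  have bb: "integrable lborel (\<lambda>t. b t * (1 - b (t + x)))" for x
  proof (rule Bochner_Integration.integrable_bound[OF b])
    show "AE t in lborel. norm (b t * (1 - b (t + x))) \<le> norm (b t)"
      by (auto simp: b_def indicator_def)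
  qed measurable
  have eq: "(LINT t|lborel. norm (indicator U (t + X n) *\<^sub>R c - indicator U t *\<^sub>R c)) =
      2 * norm c * (LINT t|lborel. b t * (1 - b (t + X n)))" for n
  proof -
    have "(LINT t|lborel. norm (indicator U (t + X n) *\<^sub>R c - indicator U t *\<^sub>R c)) =
        (LINT t|lborel. norm c * (2 * (b t * (1 - b (t + X n))) + b (t + X n) - b t))"
      by (intro Bochner_Integration.integral_cong refl) (auto simp: b_def indicator_def)
    also have "\<dots> = norm c * (2 * (LINT t|lborel. b t * (1 - b (t + X n))) + (LINT t|lborel. b (t + X n)) - (LINT t|lborel. b t))"
      using b b' bb by simp
    finally show ?thesis by (simp add: integral_translate)
  qed
  have "(\<lambda>n. LINT t|lborel. b t * (1 - b (t + X n))) \<longlonglongrightarrow> integral\<^sup>L lborel (\<lambda>t::real. 0)"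
  proof (rule integral_dominated_convergence[where w = b])
    show "AE t in lborel. (\<lambda>n. b t * (1 - b (t + X n))) \<longlonglongrightarrow> 0"
    proof (rule AE_I2)
      fix t
      show "(\<lambda>n. b t * (1 - b (t + X n))) \<longlonglongrightarrow> 0"
      proof (cases "t \<in> U")
        case True
        have "(\<lambda>n. t + X n) \<longlonglongrightarrow> t + 0" by (intro tendsto_intros X)
        then have "eventually (\<lambda>n. t + X n \<in> U) sequentially"
          using True U(1) by (simp add: topological_tendstoD)
        then have "eventually (\<lambda>n. b t * (1 - b (t + X n)) = 0) sequentially"
          by eventually_elim (simp add: b_def)
        then show ?thesis by (rule tendsto_eventually)
      qed (simp add: b_def)
    qed
    show "AE t in lborel. norm (b t * (1 - b (t + X n))) \<le> b t" for n
      by (auto simp: b_def indicator_def)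
  qed (use b in auto)
  then have "(\<lambda>n. 2 * norm c * (LINT t|lborel. b t * (1 - b (t + X n)))) \<longlonglongrightarrow> 2 * norm c * 0"
    by (intro tendsto_intros) simp
  then show ?thesis unfolding eq by simp
qed

text \<open>Indicators of sets of finite measure are reduced to open sets by outer regularity; sums
  and dominated limits then reach every integrable function.\<close>

lemma L1_translation_continuous:
  fixes u :: "real \<Rightarrow> complex"
  assumes "integrable lborel u" and X: "X \<longlonglongrightarrow> 0"
  shows "(\<lambda>n. LINT t|lborel. norm (u (t + X n) - u t)) \<longlonglongrightarrow> 0"
  using assms(1)
proof (induction rule: integrable_induct)
  case (base A c)
  then have A: "A \<in> sets borel" "emeasure lborel A < \<infinity>" by auto
  show ?case
  proof (rule L1_translation_approx)
    show "complex_integrable lborel (\<lambda>x. indicat_real A x *\<^sub>R c)" using A by simp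
    fix \<epsilon> :: real assume "\<epsilon> > 0"
    \<comment> \<open>The added 1 keeps the quotient defined when \<open>c = 0\<close>.\<close>
    define \<epsilon>' where "\<epsilon>' = \<epsilon> / (norm c + 1)"
    have e': "\<epsilon>' > 0" "norm c * \<epsilon>' \<le> \<epsilon>"
      using \<open>\<epsilon> > 0\<close> by (auto simp: \<epsilon>'_def field_simps add_pos_nonneg add_nonneg_pos)
    obtain U where U: "open U" "A \<subseteq> U" "U - A \<in> lmeasurable" "emeasure lebesgue (U - A) < ennreal \<epsilon>'"
      using sets_lebesgue_outer_open[of A \<epsilon>'] A e' by auto
    have UA: "U - A \<in> sets borel" using U A by auto
    then have fin: "emeasure lborel (U - A) < ennreal \<epsilon>'" using U by simp
    have "emeasure lborel U \<le> emeasure lborel (U - A) + emeasure lborel A"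
      using emeasure_subadditive[of "U - A" lborel A] A U(2) UA by (simp add: Un_absorb2)
    also have "\<dots> < \<infinity>" using fin A by (simp add: less_top order_less_trans)
    finally have finU: "emeasure lborel U < \<infinity>" .
    show "\<exists>v. complex_integrable lborel v \<and>
         (LINT t|lborel. norm (indicat_real A t *\<^sub>R c - v t)) \<le> \<epsilon> \<and>
         (\<lambda>n. LINT t|lborel. norm (v (t + X n) - v t)) \<longlonglongrightarrow> 0"
    proof (intro exI[of _ "\<lambda>t. indicator U t *\<^sub>R c"] conjI L1_translation_open U finU X)
      show "complex_integrable lborel (\<lambda>t. indicat_real U t *\<^sub>R c)" using U finU by simp
      have "(LINT t|lborel. norm (indicat_real A t *\<^sub>R c - indicat_real U t *\<^sub>R c)) = (LINT t|lborel. norm c * indicator (U - A) t)"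
        using U(2) by (intro Bochner_Integration.integral_cong refl) (auto simp: indicator_def)
      also have "\<dots> = norm c * measure lborel (U - A)" by simp
      also have "\<dots> \<le> norm c * \<epsilon>'"
        using fin e' by (intro mult_left_mono) (auto simp: measure_def enn2real_leI)
      also have "\<dots> \<le> \<epsilon>" by (rule e')
      finally show "(LINT t|lborel. norm (indicat_real A t *\<^sub>R c - indicat_real U t *\<^sub>R c)) \<le> \<epsilon>" .
    qed
  qed
next
  case (add f g)
  have 1: "integrable lborel (\<lambda>t. norm (f (t + X n) - f t))" "integrable lborel (\<lambda>t. norm (g (t + X n) - g t))" for n
    using add.hyps integrable_translate_iff[of f "X n"] integrable_translate_iff[of g "X n"] by auto
  show ?case
  proof (rule tendsto_sandwich[OF _ _ tendsto_const])
    show "(\<lambda>n. (LINT t|lborel. norm (f (t + X n) - f t)) + (LINT t|lborel. norm (g (t + X n) - g t))) \<longlonglongrightarrow> 0"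
      using tendsto_add[OF add.IH] by simp
    show "\<forall>\<^sub>F n in sequentially. (LINT t|lborel. norm (f (t + X n) + g (t + X n) - (f t + g t)))
        \<le> (LINT t|lborel. norm (f (t + X n) - f t)) + (LINT t|lborel. norm (g (t + X n) - g t))"
      unfolding Bochner_Integration.integral_add[OF 1, symmetric]
      using 1 by (intro always_eventually allI integral_mono') (auto simp: norm_diff_triangle_ineq)
  qed auto
next
  case (lim f s)
  show ?case
  proof (rule L1_translation_approx[OF lim.hyps(4)])
    fix \<epsilon> :: real assume "\<epsilon> > 0"
    have "(\<lambda>i. LINT t|lborel. norm (f t - s i t)) \<longlonglongrightarrow> integral\<^sup>L lborel (\<lambda>t::real. 0)"
    \<comment> \<open>The approximants satisfy \<open>norm (s i t) \<le> 2 * norm (f t)\<close>,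
      whence the factor 3 for the difference.\<close>
    proof (rule integral_dominated_convergence[where w = "\<lambda>t. 3 * norm (f t)"])
      show "AE t in lborel. (\<lambda>i. norm (f t - s i t)) \<longlonglongrightarrow> 0"
      proof (rule AE_I2)
        fix t
        have "(\<lambda>i. norm (f t - s i t)) \<longlonglongrightarrow> norm (f t - f t)"
          using lim.hyps(2)[of t] by (intro tendsto_intros) auto
        then show "(\<lambda>i. norm (f t - s i t)) \<longlonglongrightarrow> 0" by simp
      qed
      show "AE t in lborel. norm (norm (f t - s i t)) \<le> 3 * norm (f t)" for i
        using lim.hyps(3)[of _ i] norm_triangle_ineq4[of "f _" "s i _"] by (intro AE_I2) (simp, smt (verit))
    qed (use lim.hyps in auto)
    then have "eventually (\<lambda>i. (LINT t|lborel. norm (f t - s i t)) < \<epsilon>) sequentially"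
      using \<open>\<epsilon> > 0\<close> by (simp add: order_tendsto_iff)
    then obtain i where "(LINT t|lborel. norm (f t - s i t)) < \<epsilon>"
      by (auto simp: eventually_sequentially)
    then show "\<exists>v. complex_integrable lborel v \<and> (LINT t|lborel. norm (f t - v t)) \<le> \<epsilon> \<and>
        (\<lambda>n. LINT t|lborel. norm (v (t + X n) - v t)) \<longlonglongrightarrow> 0"
      using lim.hyps(1) lim.IH by (intro exI[of _ "s i"]) auto
  qed
qed

text \<open>The inverse of the Mazur map \<open>z \<mapsto> \<bar>z\<bar> z\<close> is Hoelder continuous of exponent 1/2,
  so translation continuity in L^1 carries over to L^2.\<close>

lemma norm_diff_power2_le_mazur:
  fixes a b :: complex
  shows "(norm (a - b))\<^sup>2 \<le> 2 * norm (norm a * a - norm b * b)"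
proof (cases "a = b")
  case False
  let ?A = "norm a" and ?B = "norm b"
  have ab: "(norm (a - b))\<^sup>2 = ?A\<^sup>2 + ?B\<^sup>2 - 2 * (a \<bullet> b)"
    by (simp add: power2_norm_eq_inner inner_diff_left inner_diff_right inner_commute)
  \<comment> \<open>The inner product of \<open>a\<close> and \<open>b\<close> occurs equally on
    both sides; right minus left is \<open>(?A + ?B) * (?A - ?B)\<^sup>2\<close>. Cauchy-Schwarz and
    \<open>norm (a - b) \<le> ?A + ?B\<close> then leave a common factor \<open>?A + ?B\<close> to
    cancel.\<close>
  have "(?A + ?B) * (norm (a - b))\<^sup>2 \<le> 2 * ((norm a * a - norm b * b) \<bullet> (a - b))"
  proof -
    have "complex_of_real ?A * a = ?A *\<^sub>R a" "complex_of_real ?B * b = ?B *\<^sub>R b"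
      by (simp_all add: scaleR_conv_of_real)
    then have "(norm a * a - norm b * b) \<bullet> (a - b) = ?A * ?A\<^sup>2 + ?B * ?B\<^sup>2 - (?A + ?B) * (a \<bullet> b)"
      by (simp add: inner_diff_left inner_diff_right inner_commute power2_norm_eq_inner algebra_simps)
    moreover have "0 \<le> (?A + ?B) * (?A - ?B)\<^sup>2" by simp
    ultimately show ?thesis unfolding ab by (simp add: algebra_simps power2_eq_square)
  qed
  also have "\<dots> \<le> 2 * (norm (norm a * a - norm b * b) * norm (a - b))"
    using norm_cauchy_schwarz by simp
  also have "\<dots> \<le> 2 * (norm (norm a * a - norm b * b) * (?A + ?B))"
    by (intro mult_left_mono norm_triangle_ineq4) auto
  finally have "(?A + ?B) * (norm (a - b))\<^sup>2 \<le> (?A + ?B) * (2 * norm (norm a * a - norm b * b))"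
    by (simp add: mult_ac)
  moreover have "?A + ?B > 0"
    using False by (metis add_nonneg_eq_0_iff add_nonneg_nonneg norm_eq_zero norm_ge_zero order_le_less)
  ultimately show ?thesis by simp
qed auto

lemma L2_translation_continuous:
  assumes f: "f \<in> L2" and X: "X \<longlonglongrightarrow> 0"
  shows "(\<lambda>n. LINT t|lborel. (norm (f (t + X n) - f t))\<^sup>2) \<longlonglongrightarrow> 0"
proof -
  note [measurable] = f[THEN L2_measurable]
  let ?u = "\<lambda>t. norm (f t) * f t"
  have "integrable lborel (\<lambda>t. norm (?u t))"
    using f[THEN L2_integrable] by (simp add: norm_mult power2_eq_square)
  then have u: "integrable lborel ?u" by (subst (asm) integrable_norm_iff) auto
  have 1: "integrable lborel (\<lambda>t. norm (?u (t + X n) - ?u t))" for n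
    using u integrable_translate_iff[of ?u "X n"] by auto
  show ?thesis
  proof (rule tendsto_sandwich[OF _ _ tendsto_const])
    show "(\<lambda>n. 2 * (LINT t|lborel. norm (?u (t + X n) - ?u t))) \<longlonglongrightarrow> 0"
      using tendsto_mult[OF tendsto_const L1_translation_continuous[OF u X], of 2] by simp
    show "\<forall>\<^sub>F n in sequentially. (LINT t|lborel. (norm (f (t + X n) - f t))\<^sup>2) \<le> 2 * (LINT t|lborel. norm (?u (t + X n) - ?u t))"
      unfolding integral_mult_right_zero[symmetric]
      using 1 norm_diff_power2_le_mazur by (intro always_eventually allI integral_mono') auto
  qed auto
qed

subsection \<open>Autocorrelations\<close>

definition corr :: "(real \<Rightarrow> complex) \<Rightarrow> real \<Rightarrow> real \<Rightarrow> complex" where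
  "corr f q \<omega> = (LINT t|lborel. f (t + q) * cnj (f t) * cis (- (2 * pi * t * \<omega>)))"

lemma L2_cis: "f \<in> L2 \<Longrightarrow> g \<in> borel_measurable borel \<Longrightarrow> (\<lambda>t. f t * cis (g t)) \<in> L2"
  by (auto simp: L2_def norm_mult)

lemma stft_eq_corr: "stft f f q \<omega> = cis (- (2 * pi * q * \<omega>)) * corr f q \<omega>"
proof -
  have "stft f f q \<omega> = (LINT t|lborel. f (t + q) * cnj (f t) * exp (- 2 * pi * \<i> * complex_of_real ((t + q) * \<omega>)))"
    unfolding stft_def
    using integral_translate[of "\<lambda>t. f t * cnj (f (t - q)) * exp (- 2 * pi * \<i> * complex_of_real (t * \<omega>))" q]
    by simp
  also have "\<dots> = (LINT t|lborel. cis (- (2 * pi * q * \<omega>)) * (f (t + q) * cnj (f t) * cis (- (2 * pi * t * \<omega>))))"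
    by (intro Bochner_Integration.integral_cong refl)
       (simp add: cis_conv_exp algebra_simps flip: exp_add)
  finally show ?thesis by (simp add: corr_def)
qed

lemma corr_bound:
  assumes "f \<in> L2" shows "norm (corr f q \<omega>) \<le> (LINT t|lborel. (norm (f t))\<^sup>2)"
proof -
  note [measurable] = assms[THEN L2_measurable]
  have 1: "(\<lambda>t. cnj (f t) * cis (- (2 * pi * t * \<omega>))) \<in> L2"
    by (intro L2_cis L2_cnj assms) measurable
  show ?thesis
    using norm_LINT_mult_le[OF L2_translate[OF assms, of q] 1, of 1] integral_translate[of "\<lambda>t. (norm (f t))\<^sup>2" q]
    by (simp add: corr_def norm_mult mult.assoc)
qed

text \<open>The difference of two values pairs a difference of translates, small in L2, with one
  fixed L2 function. This is what later turns blurred identities into identities at a prescribed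
  lag.\<close>

lemma isCont_corr:
  assumes f: "f \<in> L2" shows "isCont (\<lambda>q. corr f q \<omega>) q"
proof -
  note [measurable] = f[THEN L2_measurable]
  have g: "(\<lambda>t. cnj (f t) * cis (- (2 * pi * t * \<omega>))) \<in> L2"
    by (intro L2_cis L2_cnj f) measurable
  define M where "M = (LINT t|lborel. (norm (f t))\<^sup>2)"
  have M: "M \<ge> 0" by (simp add: M_def)
  have "(\<lambda>n. corr f (Y n) \<omega>) \<longlonglongrightarrow> corr f q \<omega>" if Y: "Y \<longlonglongrightarrow> q" for Y
  proof (rule LIMSEQ_I)
    fix r :: real assume r: "r > 0"
    \<comment> \<open>Large enough that the fixed factor contributes
      \<open>r * M / (2 * (M + 1))\<close>, less than \<open>r / 2\<close>; the translates then only
      have to satisfy \<open>D n < r / \<delta>\<close>.\<close>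
    define \<delta> where "\<delta> = (M + 1) / r"
    have \<delta>: "\<delta> > 0" "1 / (2 * \<delta>) * M < r / 2"
      using r M by (auto simp: \<delta>_def field_simps add_nonneg_pos)
    define D where "D n = (LINT t|lborel. (norm (f (t + Y n) - f (t + q)))\<^sup>2)" for n
    have D: "D n = (LINT t|lborel. (norm (f (t + (Y n - q)) - f t))\<^sup>2)" for n
      using integral_translate[of "\<lambda>t. (norm (f (t + (Y n - q)) - f t))\<^sup>2" q] by (simp add: D_def)
    have "(\<lambda>n. Y n - q) \<longlonglongrightarrow> 0" using Y by (simp add: LIM_zero)
    from LIMSEQ_D[OF L2_translation_continuous[OF f this], of "r / \<delta>"] r \<delta>(1) obtain N
      where N: "\<And>n. n \<ge> N \<Longrightarrow> D n < r / \<delta>" by (auto simp: D)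
    have "norm (corr f (Y n) \<omega> - corr f q \<omega>) < r" if "n \<ge> N" for n
    proof -
      have i: "integrable lborel (\<lambda>t. f (t + x) * (cnj (f t) * cis (- (2 * pi * t * \<omega>))))" for x
        by (intro L2_mult_integrable L2_translate f g)
      have "corr f (Y n) \<omega> - corr f q \<omega> =
          (LINT t|lborel. (f (t + Y n) - f (t + q)) * (cnj (f t) * cis (- (2 * pi * t * \<omega>))))"
        using Bochner_Integration.integral_diff[OF i i, of "Y n" q]
        by (simp add: corr_def left_diff_distrib mult.assoc)
      also have "norm \<dots> \<le> \<delta> / 2 * D n + 1 / (2 * \<delta>) * M"
        using norm_LINT_mult_le[OF L2_diff[OF L2_translate[OF f] L2_translate[OF f]] g \<delta>(1), of "Y n" q]
        by (simp add: D_def M_def norm_mult)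
      also have "\<delta> / 2 * D n \<le> r / 2"
        using N[OF that] \<delta>(1) by (simp add: field_simps)
      finally show ?thesis using \<delta>(2) by linarith
    qed
    then show "\<exists>N. \<forall>n\<ge>N. norm (corr f (Y n) \<omega> - corr f q \<omega>) < r" by blast
  qed
  then show ?thesis
    unfolding isCont_def by (subst LIMSEQ_SEQ_conv[symmetric]) auto
qed

lemma corr_measurable: "f \<in> L2 \<Longrightarrow> (\<lambda>q. corr f q \<omega>) \<in> borel_measurable borel"
  by (intro borel_measurable_continuous_onI continuous_at_imp_continuous_on ballI isCont_corr)

section \<open>Uniqueness of Fourier transforms, and spectra of autocorrelations\<close>

lemma normal_density_even: "normal_density 0 e (- x) = normal_density 0 e x"
  by (simp add: normal_density_def)

text \<open>The blurred inversion formula sees the transform only under an integral, so every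
  Gaussian average of \<open>w\<close> around \<open>s\<close> vanishes. Continuity upgrades this to
  the value at the point \<open>s\<close>.\<close>

lemma fourier_eq_0_AE_imp:
  assumes w: "integrable lborel w" and cont: "\<And>x. isCont w x" and bd: "\<And>x. norm (w x) \<le> K"
    and z: "AE \<omega> in lborel. fourier w \<omega> = 0"
  shows "w s = 0"
proof -
  have [measurable]: "w \<in> borel_measurable borel"
    using borel_measurable_integrable[OF w] by simp
  have "(LINT r|lborel. normal_density 0 (inverse (Suc n)) r * w (s + r)) = 0" for n
  proof -
    let ?e = "inverse (real (Suc n))"
    have "0 = (LINT \<omega>|lborel. fourier w \<omega> * gauss ?e \<omega> * cis (2 * pi * s * \<omega>))"
      using z by (subst integral_cong_AE[where g = "\<lambda>_. 0"]) auto
    also have "\<dots> = (LINT t|lborel. w t * normal_density 0 ?e (s - t))"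
      by (rule fourier_gauss[OF w]) simp
    also have "\<dots> = (LINT r|lborel. w (r + s) * normal_density 0 ?e (- r))"
      using integral_translate[of "\<lambda>t. w t * complex_of_real (normal_density 0 ?e (s - t))" s] by simp
    also have "\<dots> = (LINT r|lborel. normal_density 0 ?e r * w (s + r))"
      unfolding normal_density_even by (simp add: mult.commute add.commute)
    finally show ?thesis by simp
  qed
  with approx_identity[OF _ bd cont, of s] have "(\<lambda>n. 0) \<longlonglongrightarrow> w s" by simp
  then show ?thesis by (simp add: LIMSEQ_const_iff)
qed

lemma normal_density_LIMSEQ_0:
  assumes "\<delta> > 0"
  shows "(\<lambda>n. normal_density 0 (inverse (real (Suc n))) \<delta>) \<longlonglongrightarrow> 0"
  unfolding normal_density_def using assms by real_asymp

lemma normal_density_antimono: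
  assumes "\<delta> \<ge> 0" "\<delta> \<le> \<bar>x\<bar>" shows "normal_density 0 e x \<le> normal_density 0 e \<delta>"
proof -
  have "\<delta>\<^sup>2 \<le> x\<^sup>2" using assms by (metis power2_abs power_mono)
  then show ?thesis by (simp add: normal_density_def divide_right_mono)
qed

text \<open>With time and frequency exchanged in the blurred Parseval identity, the autocorrelation
  transform at \<omega> is a limit of blurred correlations of two spectra in [-B, B] at lag
  \<omega>. For such a lag the supports lie apart, and the Gaussian kernel tends to 0 uniformly
  across the gap.\<close>

lemma corr_bandlimited:
  assumes F: "F \<in> L2" "integrable lborel F" and supp: "\<And>\<xi>. \<bar>\<xi>\<bar> > B \<Longrightarrow> F \<xi> = 0"
    and \<omega>: "\<bar>\<omega>\<bar> > 2 * B"
  shows "corr (\<lambda>t. fourier F (- t)) q \<omega> = 0"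
proof -
  \<comment> \<open>The gap between [-B, B] and its translate by \<omega>: for \<open>t\<close> and
    \<open>t'\<close> in [-B, B] the kernel is evaluated at distance at least \<delta> from
    0.\<close>
  define \<delta> where "\<delta> = \<bar>\<omega>\<bar> - 2 * B"
  have \<delta>: "\<delta> > 0" using \<omega> by (simp add: \<delta>_def)
  note [measurable] = F(1)[THEN L2_measurable]
  \<comment> \<open>The time shift by \<open>q\<close> becomes a modulation of the spectrum, which
    leaves support and modulus unchanged.\<close>
  define E where "E = (\<lambda>\<xi>. F \<xi> * cis (2 * pi * \<xi> * q))"
  have E: "integrable lborel E"
    unfolding E_def by (rule integrable_mult_bounded[where K = 1, OF F(2)]) auto
  have ft: "fourier F (t - q) = fourier E t" for t
    unfolding fourier_def E_def mult.assoc cis_mult by (simp add: algebra_simps)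
  have L2: "fourier F \<in> L2" by (rule fourier_L2[OF F])
  have L2': "(\<lambda>t. fourier F (t - q)) \<in> L2" by (rule L2_translate_diff[OF L2])
  have int: "integrable lborel (\<lambda>t. fourier E t * cnj (fourier F t))"
    using L2_mult_cnj_integrable[OF L2' L2] unfolding ft .
  have eq: "corr (\<lambda>t. fourier F (- t)) q \<omega> = (LINT t|lborel. fourier E t * cnj (fourier F t) * cis (2 * pi * \<omega> * t))"
    unfolding corr_def
    by (subst integral_reflect[symmetric, where t = 0]) (simp add: ft mult_ac flip: ft)
  let ?e = "\<lambda>n. inverse (real (Suc n))"
  let ?I = "\<lambda>n. LINT t|lborel. fourier E t * cnj (fourier F t) * gauss (?e n) t * cis (2 * pi * \<omega> * t)"
  have "?I \<longlonglongrightarrow> (LINT t|lborel. fourier E t * cnj (fourier F t) * cis (2 * pi * \<omega> * t))"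
  proof (rule integral_dominated_convergence[where w = "\<lambda>t. norm (fourier E t * cnj (fourier F t))"])
    show "AE t in lborel. (\<lambda>n. fourier E t * cnj (fourier F t) * gauss (?e n) t * cis (2 * pi * \<omega> * t))
        \<longlonglongrightarrow> fourier E t * cnj (fourier F t) * cis (2 * pi * \<omega> * t)"
    proof (rule AE_I2)
      fix t
      have "(\<lambda>n. fourier E t * cnj (fourier F t) * complex_of_real (gauss (?e n) t) * cis (2 * pi * \<omega> * t))
        \<longlonglongrightarrow> fourier E t * cnj (fourier F t) * of_real 1 * cis (2 * pi * \<omega> * t)"
        by (intro tendsto_intros LIMSEQ_gauss)
      then show "(\<lambda>n. fourier E t * cnj (fourier F t) * complex_of_real (gauss (?e n) t) * cis (2 * pi * \<omega> * t))
        \<longlonglongrightarrow> fourier E t * cnj (fourier F t) * cis (2 * pi * \<omega> * t)" by simp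
    qed
    show "AE t in lborel. norm (fourier E t * cnj (fourier F t) * gauss (?e n) t * cis (2 * pi * \<omega> * t))
        \<le> norm (fourier E t * cnj (fourier F t))" for n
      using gauss_nonneg gauss_le_1 by (intro AE_I2) (simp add: norm_mult mult_left_le)
    have [measurable]: "E \<in> borel_measurable borel" by (simp add: E_def)
    show "(\<lambda>t. fourier E t * cnj (fourier F t) * cis (2 * pi * \<omega> * t)) \<in> borel_measurable lborel"
      "(\<lambda>t. fourier E t * cnj (fourier F t) * gauss (?e n) t * cis (2 * pi * \<omega> * t)) \<in> borel_measurable lborel" for n
      by measurable
  qed (use int in auto)
  moreover have "?I \<longlonglongrightarrow> 0"
  proof (rule Lim_null_comparison)
    define N where "N = (LINT t|lborel. norm (F t))"
    show "\<forall>\<^sub>F n in sequentially. norm (?I n) \<le> normal_density 0 (?e n) \<delta> * N * N"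
    proof (intro always_eventually allI)
      fix n
      let ?g = "normal_density 0 (?e n)"
      have pt: "norm (cnj (F t') * E t * ?g (\<omega> + t' - t)) \<le> norm (F t') * ?g \<delta> * norm (F t)" for t t'
      proof (cases "F t' = 0 \<or> F t = 0")
        case False
        then have "\<bar>t\<bar> \<le> B" "\<bar>t'\<bar> \<le> B" using supp by (meson not_le_imp_less)+
        then have "?g (\<omega> + t' - t) \<le> ?g \<delta>"
          using \<delta> by (intro normal_density_antimono) (auto simp: \<delta>_def)
        then show ?thesis
          by (simp add: norm_mult E_def mult_ac mult_left_mono)
      qed (auto simp: E_def)
      have nF: "integrable lborel (\<lambda>t. norm (F t))" using F(2) by simp
      have inner: "norm (LINT t|lborel. cnj (F t') * E t * ?g (\<omega> + t' - t)) \<le> norm (F t') * (?g \<delta> * N)" for t'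
      proof -
        have "norm (LINT t|lborel. cnj (F t') * E t * ?g (\<omega> + t' - t)) \<le>
            (LINT t|lborel. norm (cnj (F t') * E t * ?g (\<omega> + t' - t)))"
          by (rule integral_norm_bound)
        also have "\<dots> \<le> (LINT t|lborel. norm (F t') * ?g \<delta> * norm (F t))"
          using nF pt by (intro integral_mono') auto
        finally show ?thesis by (simp add: N_def)
      qed
      have "?I n = (LINT t'|lborel. (LINT t|lborel. cnj (F t') * E t * ?g (\<omega> + t' - t)))"
        by (rule fourier_mult_gauss[OF E F(2)]) simp
      also have "norm \<dots> \<le> (LINT t'|lborel. norm (LINT t|lborel. cnj (F t') * E t * ?g (\<omega> + t' - t)))"
        by (rule integral_norm_bound)
      also have "\<dots> \<le> (LINT t'|lborel. norm (F t') * (?g \<delta> * N))"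
        using nF inner by (intro integral_mono') (auto simp: N_def)
      also have "\<dots> = ?g \<delta> * N * N" by (simp add: N_def)
      finally show "norm (?I n) \<le> ?g \<delta> * N * N" .
    qed
    show "(\<lambda>n. normal_density 0 (?e n) \<delta> * N * N) \<longlonglongrightarrow> 0"
      by (intro tendsto_mult_left_zero normal_density_LIMSEQ_0 \<delta>)
  qed
  ultimately show ?thesis unfolding eq using LIMSEQ_unique by blast
qed

subsection \<open>Spectrograms and autocorrelations\<close>

text \<open>Formally, the Fourier transform in \<open>\<eta>\<close> of the spectrogram, integrated against a character in \<open>x\<close>,
  is the product of \<open>corr f\<close> and the conjugate of \<open>corr \<phi>\<close>. The Gaussian weight makes all
  integrals converge absolutely.\<close>

lemma spectrogram_gauss:
  assumes f: "f \<in> L2" and \<phi>: "\<phi> \<in> L2" and e: "e > 0"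
  shows "(LINT x|lborel. cis (- (2 * pi * x * \<omega>)) *
            (LINT \<eta>|lborel. complex_of_real ((norm (fourier (\<lambda>t. f t * cnj (\<phi> (t - x))) \<eta>))\<^sup>2) * gauss e \<eta> * cis (2 * pi * s * \<eta>))) =
         (LINT r|lborel. normal_density 0 e r * (corr f (s + r) \<omega> * cnj (corr \<phi> (s + r) \<omega>)))"
proof -
  note [measurable] = f[THEN L2_measurable] \<phi>[THEN L2_measurable]
  let ?P = "lborel \<Otimes>\<^sub>M lborel :: (real \<times> real) measure"
  interpret P: pair_sigma_finite ?P "lborel :: real measure" ..
  define Nf where "Nf = (LINT t|lborel. (norm (f t))\<^sup>2)"
  define N\<phi> where "N\<phi> = (LINT t|lborel. (norm (\<phi> t))\<^sup>2)"
  \<comment> \<open>\<open>A\<close> collects the factors without \<open>x\<close> and is integrable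
    over the plane by Schur's test; \<open>V\<close> collects the window factors and has integral
    norm in \<open>x\<close> at most \<open>N\<phi>\<close>, uniformly in \<open>p\<close>. Together
    they give absolute convergence of the triple integral.\<close>
  define A where "A = (\<lambda>p. cnj (f (fst p)) * f (snd p) * normal_density 0 e (s + fst p - snd p))"
  define V where "V = (\<lambda>p x. \<phi> (fst p - x) * cnj (\<phi> (snd p - x)) * cis (- (2 * pi * x * \<omega>)))"
  have [measurable]: "A \<in> borel_measurable ?P" unfolding A_def by measurable
  have [measurable]: "(\<lambda>q. V (fst q) (snd q)) \<in> borel_measurable (?P \<Otimes>\<^sub>M lborel)"
    unfolding V_def by measurable
  have normA: "norm (A p) = normal_density 0 e (s + fst p - snd p) * (norm (f (fst p)) * norm (f (snd p)))" for p
    by (simp add: A_def norm_mult)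
  have A: "integrable ?P A"
    using schur_gauss(1)[OF f e, of s] unfolding normA[symmetric] by (subst (asm) integrable_norm_iff) auto
  have \<phi>L: "(\<lambda>x. \<phi> (a - x)) \<in> L2" for a by (rule L2_reflect[OF \<phi>])
  have V_int: "integrable lborel (V p)" for p
    unfolding V_def by (rule integrable_mult_bounded[where K = 1]) (auto intro!: L2_mult_cnj_integrable \<phi>L)
  have V_le: "(LINT x|lborel. norm (V p x)) \<le> N\<phi>" for p
    using LINT_norm_mult_le[OF \<phi>L \<phi>L, of 1 "fst p" "snd p"] integral_reflect[of "\<lambda>t. (norm (\<phi> t))\<^sup>2"]
    by (simp add: V_def norm_mult N\<phi>_def)
  have int: "integrable (?P \<Otimes>\<^sub>M lborel) (\<lambda>q. A (fst q) * V (fst q) (snd q))"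
  proof (rule P.Fubini_integrable)
    have "integrable ?P (\<lambda>p. N\<phi> * norm (A p))" using A by simp
    then show "integrable ?P (\<lambda>p. LINT x|lborel. norm (A (fst (p, x)) * V (fst (p, x)) (snd (p, x))))"
    proof (rule Bochner_Integration.integrable_bound)
      show "AE p in ?P. norm (LINT x|lborel. norm (A (fst (p, x)) * V (fst (p, x)) (snd (p, x)))) \<le> norm (N\<phi> * norm (A p))"
      proof (rule AE_I2)
        fix p
        have "N\<phi> \<ge> 0" by (simp add: N\<phi>_def)
        then show "norm (LINT x|lborel. norm (A (fst (p, x)) * V (fst (p, x)) (snd (p, x)))) \<le> norm (N\<phi> * norm (A p))"
          using mult_right_mono[OF V_le, of "norm (A p)" p]
          by (simp add: norm_mult abs_mult mult.commute)
      qed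
    qed measurable
    show "AE p in ?P. integrable lborel (\<lambda>x. A (fst (p, x)) * V (fst (p, x)) (snd (p, x)))"
      using V_int by (intro AE_I2) simp
  qed measurable
  then have int': "integrable (?P \<Otimes>\<^sub>M lborel) (\<lambda>(p, x). A p * V p x)" by (simp add: case_prod_beta')
  \<comment> \<open>Substituting \<open>x = fst p - y\<close> recentres the window, so that
    integrating out \<open>x\<close> leaves the autocorrelation of \<phi> at lag
    \<open>snd p - fst p\<close>.\<close>
  have V_corr: "(LINT x|lborel. V p x) = cis (- (2 * pi * fst p * \<omega>)) * cnj (corr \<phi> (snd p - fst p) \<omega>)" for p
  proof -
    have "(LINT x|lborel. V p x) = (LINT y|lborel. V p (fst p - y))"
      by (rule integral_reflect[symmetric])
    also have "\<dots> = (LINT y|lborel. cis (- (2 * pi * fst p * \<omega>)) * cnj (\<phi> (y + (snd p - fst p)) * cnj (\<phi> y) * cis (- (2 * pi * y * \<omega>))))"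
    proof (intro Bochner_Integration.integral_cong refl)
      fix y
      have "cis (- (2 * pi * (fst p - y) * \<omega>)) = cis (- (2 * pi * fst p * \<omega>)) * cis (2 * pi * y * \<omega>)"
        unfolding cis_mult by (rule arg_cong[of _ _ cis]) (simp add: algebra_simps)
      moreover have "\<phi> (snd p - (fst p - y)) = \<phi> (y + (snd p - fst p))" by (simp add: algebra_simps)
      ultimately show "V p (fst p - y) = cis (- (2 * pi * fst p * \<omega>)) * cnj (\<phi> (y + (snd p - fst p)) * cnj (\<phi> y) * cis (- (2 * pi * y * \<omega>)))"
        by (simp add: V_def cis_cnj)
    qed
    finally show ?thesis
      by (simp only: corr_def integral_mult_right_zero Bochner_Integration.integral_cnj)
  qed
  have int_C: "integrable ?P (\<lambda>p. LINT x|lborel. A p * V p x)"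
    using P.integrable_fst'[OF int] by simp
  have "(LINT x|lborel. cis (- (2 * pi * x * \<omega>)) *
            (LINT \<eta>|lborel. complex_of_real ((norm (fourier (\<lambda>t. f t * cnj (\<phi> (t - x))) \<eta>))\<^sup>2) * gauss e \<eta> * cis (2 * pi * s * \<eta>)))
      = (LINT x|lborel. LINT p|?P. A p * V p x)"
  proof (rule integral_cong_AE)
    \<comment> \<open>Fubini provides integrable slices in \<open>(t', t)\<close> only for almost
      every \<open>x\<close>, so the two integrands are compared almost everywhere.\<close>
    have "AE x in lborel. integrable ?P (\<lambda>p. A p * V p x)"
      using P.AE_integrable_snd[OF int'] .
    then show "AE x in lborel. cis (- (2 * pi * x * \<omega>)) *
            (LINT \<eta>|lborel. complex_of_real ((norm (fourier (\<lambda>t. f t * cnj (\<phi> (t - x))) \<eta>))\<^sup>2) * gauss e \<eta> * cis (2 * pi * s * \<eta>)) =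
           (LINT p|?P. A p * V p x)"
    proof eventually_elim
      case (elim x)
      define u where "u = (\<lambda>t. f t * cnj (\<phi> (t - x)))"
      have u: "integrable lborel u"
        unfolding u_def by (intro L2_mult_cnj_integrable f L2_translate_diff \<phi>)
      have "(LINT \<eta>|lborel. complex_of_real ((norm (fourier u \<eta>))\<^sup>2) * gauss e \<eta> * cis (2 * pi * s * \<eta>)) =
          (LINT t'|lborel. (LINT t|lborel. cnj (u t') * u t * normal_density 0 e (s + t' - t)))"
        unfolding complex_norm_square by (rule fourier_mult_gauss[OF u u e])
      also have "cis (- (2 * pi * x * \<omega>)) * \<dots> = (LINT t'|lborel. (LINT t|lborel. A (t', t) * V (t', t) x))"
        by (simp add: A_def V_def u_def mult_ac flip: integral_mult_right_zero)
      also have "\<dots> = (LINT p|?P. A p * V p x)"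
        by (rule lborel_pair.integral_fst'[OF elim])
      finally show ?case unfolding u_def .
    qed
    have "(\<lambda>(x, \<eta>). complex_of_real ((norm (fourier (\<lambda>t. f t * cnj (\<phi> (t - x))) \<eta>))\<^sup>2) * gauss e \<eta> * cis (2 * pi * s * \<eta>))
       \<in> borel_measurable (lborel \<Otimes>\<^sub>M lborel)"
      unfolding fourier_def by measurable
    then show "(\<lambda>x. cis (- (2 * pi * x * \<omega>)) *
            (LINT \<eta>|lborel. complex_of_real ((norm (fourier (\<lambda>t. f t * cnj (\<phi> (t - x))) \<eta>))\<^sup>2) * gauss e \<eta> * cis (2 * pi * s * \<eta>)))
       \<in> borel_measurable lborel"
      by measurable
    show "(\<lambda>x. LINT p|?P. A p * V p x) \<in> borel_measurable lborel"
      using P.integrable_snd[OF int'] by (rule borel_measurable_integrable)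
  qed
  also have "\<dots> = (LINT p|?P. LINT x|lborel. A p * V p x)"
    by (rule P.Fubini_integral[OF int'])
  also have "\<dots> = (LINT t'|lborel. LINT t|lborel. LINT x|lborel. A (t', t) * V (t', t) x)"
    by (rule lborel_pair.integral_fst'[OF int_C, symmetric])
  \<comment> \<open>Substituting \<open>t = r + (t' + s)\<close> makes the kernel and the lag
    \<open>s + r\<close> depend on \<open>r\<close> alone. After one more exchange, the inner
    integral over \<open>t'\<close> is \<open>corr f (s + r) \<omega>\<close>.\<close>
  also have "\<dots> = (LINT t'|lborel. LINT r|lborel. normal_density 0 e r * cnj (corr \<phi> (s + r) \<omega>) *
        (f (t' + (s + r)) * cnj (f t') * cis (- (2 * pi * t' * \<omega>))))"
  proof (rule Bochner_Integration.integral_cong[OF refl])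
    fix t'
    have "(LINT t|lborel. LINT x|lborel. A (t', t) * V (t', t) x) =
        (LINT r|lborel. LINT x|lborel. A (t', r + (t' + s)) * V (t', r + (t' + s)) x)"
      by (rule integral_translate[symmetric])
    also have "\<dots> = (LINT r|lborel. normal_density 0 e r * cnj (corr \<phi> (s + r) \<omega>) *
        (f (t' + (s + r)) * cnj (f t') * cis (- (2 * pi * t' * \<omega>))))"
    proof (rule Bochner_Integration.integral_cong[OF refl])
      fix r
      have 1: "normal_density 0 e (s + t' - (r + (t' + s))) = normal_density 0 e r"
        by (simp add: normal_density_def)
      have 2: "r + (t' + s) - t' = s + r" by simp
      have 3: "f (r + (t' + s)) = f (t' + (s + r))" by (simp add: add_ac)
      show "(LINT x|lborel. A (t', r + (t' + s)) * V (t', r + (t' + s)) x) =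
          normal_density 0 e r * cnj (corr \<phi> (s + r) \<omega>) * (f (t' + (s + r)) * cnj (f t') * cis (- (2 * pi * t' * \<omega>)))"
        unfolding integral_mult_right_zero V_corr A_def fst_conv snd_conv 1 2 3 by (simp only: mult_ac)
    qed
    finally show "(LINT t|lborel. LINT x|lborel. A (t', t) * V (t', t) x) =
        (LINT r|lborel. normal_density 0 e r * cnj (corr \<phi> (s + r) \<omega>) *
        (f (t' + (s + r)) * cnj (f t') * cis (- (2 * pi * t' * \<omega>))))" .
  qed
  also have "\<dots> = (LINT r|lborel. LINT t'|lborel. normal_density 0 e r * cnj (corr \<phi> (s + r) \<omega>) *
        (f (t' + (s + r)) * cnj (f t') * cis (- (2 * pi * t' * \<omega>))))"
  proof (rule lborel_pair.Fubini_integral)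
    note [measurable] = corr_measurable[OF \<phi>]
    have ff: "integrable lborel (\<lambda>t'. f (t' + (s + r)) * cnj (f t') * cis (- (2 * pi * t' * \<omega>)))" for r
      by (rule integrable_mult_bounded[where K = 1]) (auto intro!: L2_mult_cnj_integrable L2_translate f)
    have ff_le: "(LINT t'|lborel. norm (f (t' + (s + r)) * cnj (f t') * cis (- (2 * pi * t' * \<omega>)))) \<le> Nf" for r
      using LINT_norm_mult_le[OF L2_translate[OF f] f, of 1 "s + r"] integral_translate[of "\<lambda>t. (norm (f t))\<^sup>2" "s + r"]
      by (simp add: norm_mult Nf_def)
    have pos: "Nf \<ge> 0" "N\<phi> \<ge> 0" by (simp_all add: Nf_def N\<phi>_def)
    show "integrable (lborel \<Otimes>\<^sub>M lborel) (\<lambda>(r, t'). normal_density 0 e r * cnj (corr \<phi> (s + r) \<omega>) *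
        (f (t' + (s + r)) * cnj (f t') * cis (- (2 * pi * t' * \<omega>))))" (is "integrable _ ?D")
    proof (rule lborel_pair.Fubini_integrable)
      show "?D \<in> borel_measurable (lborel \<Otimes>\<^sub>M lborel)" by measurable
      show "AE r in lborel. integrable lborel (\<lambda>t'. ?D (r, t'))"
        using ff by (intro AE_I2) simp
      have "integrable lborel (\<lambda>r. N\<phi> * Nf * normal_density 0 e r)"
        using e by simp
      then show "integrable lborel (\<lambda>r. LINT t'|lborel. norm (?D (r, t')))"
      proof (rule Bochner_Integration.integrable_bound)
        show "AE r in lborel. norm (LINT t'|lborel. norm (?D (r, t'))) \<le> norm (N\<phi> * Nf * normal_density 0 e r)"
        proof (rule AE_I2)
          fix r
          have "norm (corr \<phi> (s + r) \<omega>) * (LINT t'|lborel. norm (f (t' + (s + r)) * cnj (f t') * cis (- (2 * pi * t' * \<omega>)))) \<le> N\<phi> * Nf"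
            using corr_bound[OF \<phi>] ff_le pos by (intro mult_mono) (auto simp: N\<phi>_def)
          moreover have "(LINT t'|lborel. norm (?D (r, t'))) = normal_density 0 e r * (norm (corr \<phi> (s + r) \<omega>) *
              (LINT t'|lborel. norm (f (t' + (s + r)) * cnj (f t') * cis (- (2 * pi * t' * \<omega>)))))"
            by (simp add: norm_mult mult.assoc)
          ultimately have "(LINT t'|lborel. norm (?D (r, t'))) \<le> normal_density 0 e r * (N\<phi> * Nf)"
            by (simp only: mult_left_mono normal_density_nonneg)
          moreover have "0 \<le> (LINT t'|lborel. norm (?D (r, t')))" by simp
          ultimately
          show "norm (LINT t'|lborel. norm (?D (r, t'))) \<le> norm (N\<phi> * Nf * normal_density 0 e r)"
            unfolding real_norm_def by (simp only: mult.commute)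
        qed
      qed measurable
    qed
  qed
  also have "\<dots> = (LINT r|lborel. normal_density 0 e r * (corr f (s + r) \<omega> * cnj (corr \<phi> (s + r) \<omega>)))"
    unfolding integral_mult_right_zero by (simp add: corr_def mult_ac)
  finally show ?thesis .
qed

lemma stft_eq_fourier: "stft \<phi> f x \<omega> = fourier (\<lambda>t. f t * cnj (\<phi> (t - x))) \<omega>"
  by (simp add: stft_def fourier_def cis_conv_exp mult_ac)

text \<open>The left side of \<open>spectrogram_gauss\<close> involves \<open>f\<close> only through
  the modulus of its transform, so the averaged products agree for every width. They are continuous
  and bounded in the lag, hence the averages converge to the value at \<open>q\<close>
  itself.\<close>

lemma corr_mult_eq_of_norm_stft_eq:
  assumes f: "f \<in> L2" and g: "g \<in> L2" and \<phi>: "\<phi> \<in> L2"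
    and eq: "\<And>x \<omega>. norm (stft \<phi> f x \<omega>) = norm (stft \<phi> g x \<omega>)"
  shows "corr f q \<omega> * cnj (corr \<phi> q \<omega>) = corr g q \<omega> * cnj (corr \<phi> q \<omega>)"
proof -
  have lim: "(\<lambda>n. LINT r|lborel. normal_density 0 (inverse (Suc n)) r * (corr h (q + r) \<omega> * cnj (corr \<phi> (q + r) \<omega>)))
      \<longlonglongrightarrow> corr h q \<omega> * cnj (corr \<phi> q \<omega>)" if h: "h \<in> L2" for h
  proof (rule approx_identity[where H = "\<lambda>q. corr h q \<omega> * cnj (corr \<phi> q \<omega>)"])
    note [measurable] = corr_measurable[OF \<phi>] corr_measurable[OF h]
    show "(\<lambda>q. corr h q \<omega> * cnj (corr \<phi> q \<omega>)) \<in> borel_measurable borel" by measurable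
    show "isCont (\<lambda>q. corr h q \<omega> * cnj (corr \<phi> q \<omega>)) q"
      by (intro continuous_intros isCont_corr h \<phi>)
    show "norm (corr h x \<omega> * cnj (corr \<phi> x \<omega>)) \<le> (LINT t|lborel. (norm (h t))\<^sup>2) * (LINT t|lborel. (norm (\<phi> t))\<^sup>2)" for x
      unfolding norm_mult complex_mod_cnj by (intro mult_mono corr_bound h \<phi>) auto
  qed
  have eq': "(LINT r|lborel. normal_density 0 (inverse (Suc n)) r * (corr f (q + r) \<omega> * cnj (corr \<phi> (q + r) \<omega>))) =
      (LINT r|lborel. normal_density 0 (inverse (Suc n)) r * (corr g (q + r) \<omega> * cnj (corr \<phi> (q + r) \<omega>)))" for n
    using eq unfolding stft_eq_fourier by (simp flip: spectrogram_gauss[OF f \<phi>] spectrogram_gauss[OF g \<phi>] del: of_nat_Suc)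
  show ?thesis
    by (rule LIMSEQ_unique[OF lim[OF f, unfolded eq'] lim[OF g]])
qed

subsection \<open>Paley--Wiener functions and sampling\<close>

lemma indicator_L2: "(\<lambda>\<xi>. indicator {-B..B} \<xi>) \<in> L2"
proof -
  have "(\<lambda>\<xi>. (norm (indicator {-B..B} \<xi> :: complex))\<^sup>2) = indicator {-B..B}"
    by (auto simp: fun_eq_iff indicator_def)
  moreover have "integrable lborel (indicat_real {-B..B})"
    by (intro integrable_real_indicator) (auto simp: emeasure_lborel_Icc_eq)
  ultimately show ?thesis by (simp add: L2_def)
qed

text \<open>The spectrum is extended by 0 to the whole line. It is integrable there as the product
  of two L2 functions, itself and the indicator of [-B, B].\<close>

lemma PW_imp_fourier:
  assumes "f \<in> PW B"
  shows "\<exists>F \<in> L2. integrable lborel F \<and> (\<forall>\<xi>. \<bar>\<xi>\<bar> > B \<longrightarrow> F \<xi> = 0) \<and>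
    (\<forall>z. f z = (LINT \<xi>|lborel. F \<xi> * exp (2 * pi * \<i> * complex_of_real \<xi> * z)))"
proof -
  from assms obtain F where F: "F \<in> L2_on {-B..B}"
    and f: "\<And>z. f z = (LINT \<xi>:{-B..B}|lborel. F \<xi> * exp (2 * pi * \<i> * complex_of_real \<xi> * z))"
    by (auto simp: PW_def)
  define F0 where "F0 = (\<lambda>\<xi>. indicator {-B..B} \<xi> *\<^sub>R F \<xi>)"
  have "(\<lambda>\<xi>. (norm (F0 \<xi>))\<^sup>2) = (\<lambda>\<xi>. indicator {-B..B} \<xi> *\<^sub>R (norm (F \<xi>))\<^sup>2)"
    by (auto simp: F0_def fun_eq_iff indicator_def)
  with F have F0: "F0 \<in> L2"
    by (simp add: L2_on_def L2_def set_borel_measurable_def set_integrable_def F0_def)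
  have "(\<lambda>\<xi>. F0 \<xi> * indicator {-B..B} \<xi>) = F0"
    by (auto simp: F0_def fun_eq_iff indicator_def)
  then have "integrable lborel F0"
    using L2_mult_integrable[OF F0 indicator_L2[of B]] by simp
  moreover have "F0 \<xi> = 0" if "\<bar>\<xi>\<bar> > B" for \<xi>
    using that by (auto simp: F0_def indicator_def)
  moreover have "f z = (LINT \<xi>|lborel. F0 \<xi> * exp (2 * pi * \<i> * complex_of_real \<xi> * z))" for z
    unfolding f set_lebesgue_integral_def F0_def by (simp add: scaleR_conv_of_real mult_ac)
  ultimately show ?thesis using F0 by blast
qed

text \<open>Because the spectrum has bounded support, the exponential series can be integrated term
  by term: its terms are bounded by \<open>norm (F \<xi>)\<close> times those of
  \<open>exp (2 * pi * B * norm z)\<close>. The result is a power series convergent at every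
  \<open>z\<close>.\<close>

lemma fourier_extension_holomorphic:
  assumes F: "integrable lborel F" and supp: "\<And>\<xi>. \<bar>\<xi>\<bar> > B \<Longrightarrow> F \<xi> = 0" and B: "B \<ge> 0"
  shows "(\<lambda>z. LINT \<xi>|lborel. F \<xi> * exp (2 * pi * \<i> * complex_of_real \<xi> * z)) holomorphic_on UNIV"
    (is "?f holomorphic_on UNIV")
proof -
  have [measurable]: "F \<in> borel_measurable borel"
    using borel_measurable_integrable[OF F] by simp
  define a where "a n = (LINT \<xi>|lborel. F \<xi> * ((2 * pi * \<i> * complex_of_real \<xi>) ^ n / fact n))" for n
  have sums: "(\<lambda>n. a n * (z - 0) ^ n) sums ?f z" for z
  proof -
    define h where "h n \<xi> = F \<xi> * ((2 * pi * \<i> * complex_of_real \<xi> * z) ^ n /\<^sub>R fact n)" for n \<xi>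
    have bd: "norm (h n \<xi>) \<le> norm (F \<xi>) * ((2 * pi * B * norm z) ^ n / fact n)" for n \<xi>
    proof (cases "F \<xi> = 0")
      case False
      then have "\<bar>\<xi>\<bar> \<le> B" using supp by (meson not_le_imp_less)
      then show ?thesis
        unfolding h_def norm_mult norm_scaleR norm_power
        by (intro mult_left_mono) (auto simp: divide_inverse mult.commute intro!: mult_left_mono power_mono mult_mono)
    qed (simp add: h_def)
    have summ: "summable (\<lambda>n. (2 * pi * B * norm z) ^ n / fact n)"
      using summable_exp[of "2 * pi * B * norm z"] by (simp add: field_simps)
    have int: "integrable lborel (h n)" for n
    proof (rule Bochner_Integration.integrable_bound)
      show "integrable lborel (\<lambda>\<xi>. norm (F \<xi>) * ((2 * pi * B * norm z) ^ n / fact n))" using F by simp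
      show "h n \<in> borel_measurable lborel" unfolding h_def by measurable
      show "AE \<xi> in lborel. norm (h n \<xi>) \<le> norm (norm (F \<xi>) * ((2 * pi * B * norm z) ^ n / fact n))"
        using order_trans[OF bd abs_ge_self] by simp
    qed
    have "(\<lambda>n. integral\<^sup>L lborel (h n)) sums (LINT \<xi>|lborel. (\<Sum>n. h n \<xi>))"
    proof (rule sums_integral)
      show "AE \<xi> in lborel. summable (\<lambda>n. norm (h n \<xi>))"
        using bd by (intro AE_I2 summable_comparison_test'[OF summable_mult[OF summ]]) simp
      have "(LINT \<xi>|lborel. norm (h n \<xi>)) \<le> (LINT \<xi>|lborel. norm (F \<xi>)) * ((2 * pi * B * norm z) ^ n / fact n)" for n
      proof -
        have "(LINT \<xi>|lborel. norm (h n \<xi>)) \<le> (LINT \<xi>|lborel. norm (F \<xi>) * ((2 * pi * B * norm z) ^ n / fact n))"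
          using F int bd by (intro integral_mono) auto
        then show ?thesis by simp
      qed
      then show "summable (\<lambda>n. LINT \<xi>|lborel. norm (h n \<xi>))"
        by (intro summable_comparison_test'[OF summable_mult[OF summ]]) simp
    qed (rule int)
    moreover have "(\<Sum>n. h n \<xi>) = F \<xi> * exp (2 * pi * \<i> * complex_of_real \<xi> * z)" for \<xi>
      unfolding h_def by (subst suminf_mult) (auto simp: summable_exp_generic exp_def)
    moreover have "integral\<^sup>L lborel (h n) = a n * (z - 0) ^ n" for n
    proof -
      have "h n = (\<lambda>\<xi>. F \<xi> * ((2 * pi * \<i> * complex_of_real \<xi>) ^ n / fact n) * z ^ n)"
        by (auto simp: h_def fun_eq_iff power_mult_distrib scaleR_conv_of_real divide_inverse)
      then show ?thesis by (simp add: a_def)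
    qed
    ultimately show ?thesis by simp
  qed
  have "?f holomorphic_on ball 0 r" for r
    by (rule power_series_holomorphic[OF sums])
  then have "?f field_differentiable at z" for z
    using holomorphic_on_imp_differentiable_at[of ?f "ball 0 (norm z + 1)" z] by simp
  then show ?thesis
    by (simp add: holomorphic_on_def field_differentiable_at_within)
qed

lemma entire_real_zeros_countable:
  assumes "f holomorphic_on UNIV"
  shows "f = (\<lambda>_. 0) \<or> countable {t. f (complex_of_real t) = 0}"
proof (cases "f constant_on UNIV")
  case True
  then obtain c where "f = (\<lambda>_. c)" by (auto simp: constant_on_def)
  then show ?thesis by (cases "c = 0") auto
next
  case False
  then have "countable {z \<in> UNIV. f z = 0}"
    using assms by (intro holomorphic_countable_zeros) auto
  then have "countable (Re ` {z. f z = 0})" by simp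
  moreover have "{t. f (complex_of_real t) = 0} \<subseteq> Re ` {z. f z = 0}"
    by (force simp: image_iff)
  ultimately show ?thesis using countable_subset by blast
qed

text \<open>Orthogonality to all lattice exponentials survives multiplication by a polynomial on the
  circle: a linear factor merely shifts the frequency by 1 up or down. \<open>F\<close> is
  generalised because a product \<open>p q\<close> is treated by applying the hypothesis for
  \<open>q\<close> to \<open>F\<close> times \<open>p\<close>.\<close>

lemma real_polynomial_cis_orthogonal:
  assumes "real_polynomial_function p"
    and "integrable lborel F" "\<And>k::int. (LINT \<xi>|lborel. F \<xi> * cis (a * k * \<xi>)) = 0"
  shows "integrable lborel (\<lambda>\<xi>. F \<xi> * complex_of_real (p (cis (a * \<xi>)))) \<and>
    (\<forall>k::int. (LINT \<xi>|lborel. F \<xi> * complex_of_real (p (cis (a * \<xi>))) * cis (a * k * \<xi>)) = 0)"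
  using assms
proof (induction arbitrary: F rule: real_polynomial_function.induct)
  case (linear p)
  \<comment> \<open>A real-linear \<open>p\<close> has
    \<open>p (cis x) = cos x * p 1 + sin x * p \<i>\<close>; these are its coefficients with respect
    to \<open>cis x\<close> and \<open>cis (- x)\<close>.\<close>
  let ?\<alpha> = "(of_real (p 1) - \<i> * of_real (p \<i>)) / 2" and ?\<beta> = "(of_real (p 1) + \<i> * of_real (p \<i>)) / 2"
  have p: "complex_of_real (p (cis x)) = ?\<alpha> * cis x + ?\<beta> * cis (- x)" for x
  proof -
    interpret bounded_linear p by (rule linear)
    have "cis x = cos x *\<^sub>R 1 + sin x *\<^sub>R \<i>" by (simp add: complex_eq_iff)
    then have "p (cis x) = cos x * p 1 + sin x * p \<i>" by (metis add scaleR real_scaleR_def)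
    then show ?thesis by (simp add: complex_eq_iff field_simps)
  qed
  have i: "integrable lborel (\<lambda>\<xi>. F \<xi> * cis (a * of_int k * \<xi>))" for k :: int
    by (rule integrable_mult_bounded[where K = 1, OF linear(2)]) auto
  have F: "F \<xi> * complex_of_real (p (cis (a * \<xi>))) * cis (a * of_int k * \<xi>) =
      ?\<alpha> * (F \<xi> * cis (a * of_int (k + 1) * \<xi>)) + ?\<beta> * (F \<xi> * cis (a * of_int (k - 1) * \<xi>))" for \<xi> and k :: int
  proof -
    have "cis (a * of_int (k + 1) * \<xi>) = cis (a * \<xi>) * cis (a * of_int k * \<xi>)"
      "cis (a * of_int (k - 1) * \<xi>) = cis (- (a * \<xi>)) * cis (a * of_int k * \<xi>)"
      unfolding cis_mult by (simp_all add: algebra_simps)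
    then show ?thesis unfolding p by (simp only: distrib_left distrib_right mult_ac)
  qed
  have "integrable lborel (\<lambda>\<xi>. F \<xi> * complex_of_real (p (cis (a * \<xi>))) * cis (a * of_int (0::int) * \<xi>))"
    unfolding F by (intro Bochner_Integration.integrable_add integrable_mult_right i)
  moreover have "(LINT \<xi>|lborel. F \<xi> * complex_of_real (p (cis (a * \<xi>))) * cis (a * of_int k * \<xi>)) = 0" for k :: int
    unfolding F using i linear(3)
    by (subst Bochner_Integration.integral_add) (auto simp del: of_int_add of_int_diff)
  ultimately show ?case by simp
next
  case (const c)
  have "F \<xi> * complex_of_real c * x = complex_of_real c * (F \<xi> * x)" for \<xi> x by simp
  note eq = this
  have "(LINT \<xi>|lborel. F \<xi> * complex_of_real c * cis (a * of_int k * \<xi>)) = 0" for k :: int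
    unfolding eq integral_mult_right_zero const(2) by simp
  then show ?case using const(1) by simp
next
  case (add p q)
  have 1: "integrable lborel (\<lambda>\<xi>. F \<xi> * complex_of_real (p (cis (a * \<xi>))))" "integrable lborel (\<lambda>\<xi>. F \<xi> * complex_of_real (q (cis (a * \<xi>))))"
    "\<And>k::int. (LINT \<xi>|lborel. F \<xi> * complex_of_real (p (cis (a * \<xi>))) * cis (a * k * \<xi>)) = 0"
    "\<And>k::int. (LINT \<xi>|lborel. F \<xi> * complex_of_real (q (cis (a * \<xi>))) * cis (a * k * \<xi>)) = 0"
    using add.IH add.prems by blast+
  have 2: "integrable lborel (\<lambda>\<xi>. F \<xi> * complex_of_real (p (cis (a * \<xi>))) * cis (a * k * \<xi>))"
    "integrable lborel (\<lambda>\<xi>. F \<xi> * complex_of_real (q (cis (a * \<xi>))) * cis (a * k * \<xi>))" for k :: int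
    by (rule integrable_mult_bounded[where K = 1, OF 1(1)] integrable_mult_bounded[where K = 1, OF 1(2)]; auto)+
  show ?case
    using 1 2 by (simp add: distrib_left distrib_right)
next
  case (mult p q)
  have "integrable lborel (\<lambda>\<xi>. F \<xi> * complex_of_real (p (cis (a * \<xi>))))"
    "\<And>k::int. (LINT \<xi>|lborel. F \<xi> * complex_of_real (p (cis (a * \<xi>))) * cis (a * k * \<xi>)) = 0"
    using mult.IH(1)[OF mult.prems] by blast+
  from mult.IH(2)[OF this] show ?case by (simp add: mult.assoc)
qed

text \<open>Stone-Weierstrass on the circle: polynomials approximate \<open>G\<close> uniformly
  there, and integrability of \<open>F\<close> converts the uniform error into an error of the
  integral.\<close>

lemma continuous_cis_orthogonal:
  fixes G :: "complex \<Rightarrow> complex"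
  assumes F: "integrable lborel F" and z: "\<And>k::int. (LINT \<xi>|lborel. F \<xi> * cis (a * k * \<xi>)) = 0"
    and G: "continuous_on (sphere 0 1) G"
  shows "(LINT \<xi>|lborel. F \<xi> * G (cis (a * \<xi>))) = 0"
proof -
  have [measurable]: "F \<in> borel_measurable borel"
    using borel_measurable_integrable[OF F] by simp
  have Gm: "(\<lambda>\<xi>. G (cis (a * \<xi>))) \<in> borel_measurable borel"
    by (intro borel_measurable_continuous_onI continuous_on_compose2[OF G] continuous_intros) auto
  define N where "N = (LINT \<xi>|lborel. norm (F \<xi>))"
  have le: "norm (LINT \<xi>|lborel. F \<xi> * G (cis (a * \<xi>))) \<le> 0 + \<epsilon>" if "\<epsilon> > 0" for \<epsilon>
  proof -
    have N: "N \<ge> 0" by (simp add: N_def)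
    define \<epsilon>' where "\<epsilon>' = \<epsilon> / (N + 1)"
    have e': "\<epsilon>' > 0" "N * \<epsilon>' \<le> \<epsilon>" using that N by (auto simp: \<epsilon>'_def field_simps)
    obtain g where g: "polynomial_function g" "\<And>w. w \<in> sphere 0 1 \<Longrightarrow> norm (G w - g w) < \<epsilon>'"
      using Stone_Weierstrass_polynomial_function[OF compact_sphere G e'(1)] by blast
    have "real_polynomial_function (Re \<circ> g)" "real_polynomial_function (Im \<circ> g)"
      using g(1) bounded_linear_Re bounded_linear_Im unfolding polynomial_function_def by blast+
    from this[THEN real_polynomial_cis_orthogonal[OF _ F z]]
    have P: "integrable lborel (\<lambda>\<xi>. F \<xi> * complex_of_real (Re (g (cis (a * \<xi>)))))"
        "integrable lborel (\<lambda>\<xi>. F \<xi> * complex_of_real (Im (g (cis (a * \<xi>)))))"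
        "(LINT \<xi>|lborel. F \<xi> * complex_of_real (Re (g (cis (a * \<xi>))))) = 0"
        "(LINT \<xi>|lborel. F \<xi> * complex_of_real (Im (g (cis (a * \<xi>))))) = 0"
      by (auto dest: spec[of _ "0::int"])
    have Fg: "(\<lambda>\<xi>. F \<xi> * g (cis (a * \<xi>))) =
        (\<lambda>\<xi>. F \<xi> * complex_of_real (Re (g (cis (a * \<xi>)))) + \<i> * (F \<xi> * complex_of_real (Im (g (cis (a * \<xi>))))))"
      by (simp add: fun_eq_iff complex_eq_iff algebra_simps)
    have gi: "integrable lborel (\<lambda>\<xi>. F \<xi> * g (cis (a * \<xi>)))" "(LINT \<xi>|lborel. F \<xi> * g (cis (a * \<xi>))) = 0"
      unfolding Fg using P by auto
    have d: "norm (F \<xi> * G (cis (a * \<xi>)) - F \<xi> * g (cis (a * \<xi>))) \<le> norm (F \<xi>) * \<epsilon>'" for \<xi>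
      using g(2)[of "cis (a * \<xi>)"] unfolding right_diff_distrib[symmetric] norm_mult
      by (intro mult_left_mono) auto
    have di: "integrable lborel (\<lambda>\<xi>. F \<xi> * G (cis (a * \<xi>)) - F \<xi> * g (cis (a * \<xi>)))"
    proof (rule Bochner_Integration.integrable_bound)
      show "integrable lborel (\<lambda>\<xi>. norm (F \<xi>) * \<epsilon>')" using F by simp
      show "(\<lambda>\<xi>. F \<xi> * G (cis (a * \<xi>)) - F \<xi> * g (cis (a * \<xi>))) \<in> borel_measurable lborel"
        using Gm borel_measurable_integrable[OF gi(1)] by simp
      show "AE \<xi> in lborel. norm (F \<xi> * G (cis (a * \<xi>)) - F \<xi> * g (cis (a * \<xi>))) \<le> norm (norm (F \<xi>) * \<epsilon>')"
        using order_trans[OF d abs_ge_self] by simp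
    qed
    have "(LINT \<xi>|lborel. F \<xi> * G (cis (a * \<xi>))) =
        (LINT \<xi>|lborel. (F \<xi> * G (cis (a * \<xi>)) - F \<xi> * g (cis (a * \<xi>))) + F \<xi> * g (cis (a * \<xi>)))"
      by simp
    also have "\<dots> = (LINT \<xi>|lborel. F \<xi> * G (cis (a * \<xi>)) - F \<xi> * g (cis (a * \<xi>)))"
      using Bochner_Integration.integral_add[OF di gi(1)] gi(2) by simp
    also have "norm \<dots> \<le> (LINT \<xi>|lborel. norm (F \<xi> * G (cis (a * \<xi>)) - F \<xi> * g (cis (a * \<xi>))))"
      by (rule integral_norm_bound)
    also have "\<dots> \<le> (LINT \<xi>|lborel. norm (F \<xi>) * \<epsilon>')"
      using F d e' by (intro integral_mono') auto
    also have "\<dots> \<le> \<epsilon>" using e' by (simp add: N_def)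
    finally show ?thesis by simp
  qed
  have "norm (LINT \<xi>|lborel. F \<xi> * G (cis (a * \<xi>))) \<le> 0"
    by (rule field_le_epsilon) (rule le)
  then show ?thesis by simp
qed

text \<open>A complex exponential in \<open>\<xi>\<close> does not have period \<open>1/c\<close>, so it is cut off near the end points of
  \<open>[-1/(2c), 1/(2c)]\<close> before it is transferred to the circle.\<close>

lemma sampling_zero:
  assumes F: "integrable lborel F" and supp: "\<And>\<xi>. \<bar>\<xi>\<bar> > B \<Longrightarrow> F \<xi> = 0"
    and c: "c > 0" "2 * B * c \<le> 1"
    and z: "\<And>k::int. (LINT \<xi>|lborel. F \<xi> * cis (2 * pi * c * k * \<xi>)) = 0"
  shows "(LINT \<xi>|lborel. F \<xi> * exp (2 * pi * \<i> * complex_of_real \<xi> * z)) = 0"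
proof -
  have [measurable]: "F \<in> borel_measurable borel"
    using borel_measurable_integrable[OF F] by simp
  define K where "K = exp (norm z / c * pi)"
  \<comment> \<open>For \<open>w = cis (2 * pi * c * \<xi>)\<close> with
    \<open>\<bar>\<xi>\<bar> < 1 / (2 * c)\<close> the argument recovers \<xi>, and
    \<open>E w\<close> is the exponential in the claim. It may jump at -1, where the principal
    argument does.\<close>
  define E where "E w = exp (\<i> * z / c * complex_of_real (Arg w))" for w
  \<comment> \<open>The cut-off vanishes at -1, which makes \<open>G n\<close> continuous on the
    circle. At any other \<open>w\<close> it equals 1 as soon as \<open>n\<close> reaches the
    inverse of \<open>norm (w + 1)\<close>.\<close>
  define m where "m n w = min 1 (real n * norm (w + 1))" for n and w :: complex
  define G where "G n w = E w * complex_of_real (m n w)" for n w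
  have m: "0 \<le> m n w" "m n w \<le> 1" "m n w \<le> real n * norm (w + 1)" for n w by (auto simp: m_def)
  have E: "norm (E w) \<le> K" for w
  proof -
    have "Re (\<i> * z / c * complex_of_real (Arg w)) \<le> norm (\<i> * z / c * complex_of_real (Arg w))"
      by (rule complex_Re_le_cmod)
    also have "\<dots> = norm z / c * \<bar>Arg w\<bar>"
      using c by (simp add: norm_mult norm_divide)
    also have "\<dots> \<le> norm z / c * pi"
      using c Arg_bounded[of w] by (intro mult_left_mono) (auto simp: abs_le_iff)
    finally show ?thesis by (simp add: E_def K_def)
  qed
  have G_le: "norm (G n w) \<le> K * m n w" for n w
    using E m by (simp add: G_def norm_mult mult_right_mono)
  have K: "K \<ge> 0" by (simp add: K_def)
  have contG: "continuous_on (sphere 0 1) (G n)" for n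
    unfolding continuous_on_eq_continuous_within
  proof
    fix w :: complex assume w: "w \<in> sphere 0 1"
    show "continuous (at w within sphere 0 1) (G n)"
    proof (cases "w = -1")
      case True
      have "((\<lambda>w. K * (real n * norm (w + 1))) \<longlongrightarrow> K * (real n * norm (-1 + 1 :: complex))) (at w within sphere 0 1)"
        unfolding True by (intro tendsto_intros)
      then have "((\<lambda>w. K * (real n * norm (w + 1))) \<longlongrightarrow> 0) (at w within sphere 0 1)" by simp
      moreover have "norm (G n w) \<le> K * (real n * norm (w + 1))" for w
        using G_le[of n w] mult_left_mono[OF m(3) K, of n w] by linarith
      ultimately have "(G n \<longlongrightarrow> 0) (at w within sphere 0 1)"
        by (intro Lim_null_comparison[where f = "G n"] always_eventually) auto
      moreover have "G n w = 0" by (simp add: G_def m_def True)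
      ultimately show ?thesis by (simp add: continuous_within)
    next
      case False
      have "w \<notin> \<real>\<^sub>\<le>\<^sub>0"
      proof
        assume "w \<in> \<real>\<^sub>\<le>\<^sub>0"
        then obtain r where "w = of_real r" "r \<le> 0" by (auto elim: nonpos_Reals_cases)
        with w False show False by auto
      qed
      then have "continuous (at w) Arg" by (rule continuous_at_Arg)
      then have "continuous (at w) (G n)"
        unfolding G_def E_def m_def by (intro continuous_intros) (use c in auto)
      then show ?thesis by (rule continuous_at_imp_continuous_at_within)
    qed
  qed
  have zero: "(LINT \<xi>|lborel. F \<xi> * G n (cis (2 * pi * c * \<xi>))) = 0" for n
    by (rule continuous_cis_orthogonal[OF F z contG])
  have "(\<lambda>n. LINT \<xi>|lborel. F \<xi> * G n (cis (2 * pi * c * \<xi>))) \<longlonglongrightarrow>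
      (LINT \<xi>|lborel. F \<xi> * exp (2 * pi * \<i> * complex_of_real \<xi> * z))"
  proof (rule integral_dominated_convergence[where w = "\<lambda>\<xi>. norm (F \<xi>) * K"])
    show "(\<lambda>\<xi>. F \<xi> * G n (cis (2 * pi * c * \<xi>))) \<in> borel_measurable lborel" for n
    proof -
      have "(\<lambda>\<xi>. G n (cis (2 * pi * c * \<xi>))) \<in> borel_measurable borel"
        by (intro borel_measurable_continuous_onI continuous_on_compose2[OF contG] continuous_intros) auto
      then show ?thesis by simp
    qed
    show "AE \<xi> in lborel. norm (F \<xi> * G n (cis (2 * pi * c * \<xi>))) \<le> norm (F \<xi>) * K" for n
      using order_trans[OF G_le mult_left_le[OF m(2) K]] by (intro AE_I2) (simp add: norm_mult mult_left_mono)
    \<comment> \<open>At the critical density \<open>c = 1 / (2 * B)\<close> these points belong to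
      [-B, B] and are mapped to -1, where the cut-off never becomes 1; being a null set, they do not
      affect the limit.\<close>
    have "AE \<xi> in lborel. \<xi> \<noteq> 1 / (2 * c)" "AE \<xi> in lborel. \<xi> \<noteq> - (1 / (2 * c))"
      by (rule AE_lborel_singleton)+
    then show "AE \<xi> in lborel. (\<lambda>n. F \<xi> * G n (cis (2 * pi * c * \<xi>))) \<longlonglongrightarrow> F \<xi> * exp (2 * pi * \<i> * complex_of_real \<xi> * z)"
    proof eventually_elim
      case (elim \<xi>)
      show ?case
      proof (cases "F \<xi> = 0")
        case False
        then have "\<bar>\<xi>\<bar> \<le> B" using supp by (meson not_le_imp_less)
        then have "2 * \<bar>\<xi>\<bar> * c \<le> 2 * B * c" using c by simp
        then have "2 * \<bar>\<xi>\<bar> * c \<le> 1" using c by linarith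
        moreover have "2 * \<bar>\<xi>\<bar> * c \<noteq> 1" using elim c by (auto simp: abs_if field_simps split: if_splits)
        ultimately have "\<bar>2 * c * \<xi>\<bar> < 1" using c by (simp add: abs_mult mult_ac)
        then have "pi * \<bar>2 * c * \<xi>\<bar> < pi * 1" by (intro mult_strict_left_mono) auto
        then have lt: "\<bar>2 * pi * c * \<xi>\<bar> < pi" by (simp add: abs_mult mult_ac)
        then have "- pi < 2 * pi * c * \<xi> \<and> 2 * pi * c * \<xi> \<le> pi" by linarith
        then have Arg: "Arg (cis (2 * pi * c * \<xi>)) = 2 * pi * c * \<xi>"
          by (intro Arg_cis) (simp only: greaterThanAtMost_iff)
        have ne: "cis (2 * pi * c * \<xi>) \<noteq> -1"
        proof
          assume "cis (2 * pi * c * \<xi>) = -1"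
          then have "Arg (-1) = 2 * pi * c * \<xi>" using Arg by simp
          moreover have "Arg (-1) = pi" using Arg_cis[of pi] by simp
          ultimately show False using lt by linarith
        qed
        define w where "w = cis (2 * pi * c * \<xi>)"
        have Ew: "E w = exp (2 * pi * \<i> * complex_of_real \<xi> * z)"
          unfolding E_def w_def Arg using c by (intro arg_cong[of _ _ exp]) simp
        have pos: "norm (w + 1) > 0" using ne by (simp add: w_def add_eq_0_iff2)
        obtain k :: nat where k: "1 < real k * norm (w + 1)" using reals_Archimedean3[OF pos] by blast
        have "m n w = 1" if "n \<ge> k" for n
        proof -
          have "real k * norm (w + 1) \<le> real n * norm (w + 1)" using that pos by (intro mult_right_mono) auto
          then show ?thesis using k by (simp add: m_def)
        qed
        then have "eventually (\<lambda>n. F \<xi> * G n w = F \<xi> * exp (2 * pi * \<i> * complex_of_real \<xi> * z)) sequentially"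
          by (intro eventually_sequentiallyI[of k]) (simp add: G_def Ew)
        then show ?thesis unfolding w_def by (rule tendsto_eventually)
      qed simp
    qed
  qed (use F in auto)
  then show ?thesis using zero by (simp add: LIMSEQ_const_iff)
qed

section \<open>Autocorrelations and samples of Paley-Wiener functions\<close>

lemma PW_holomorphic:
  assumes "f \<in> PW B" "B > 0" shows "f holomorphic_on UNIV"
proof -
  obtain F where F: "F \<in> L2" "integrable lborel F" "\<And>\<xi>. \<bar>\<xi>\<bar> > B \<Longrightarrow> F \<xi> = 0"
    and f: "\<And>z. f z = (LINT \<xi>|lborel. F \<xi> * exp (2 * pi * \<i> * complex_of_real \<xi> * z))"
    using PW_imp_fourier[OF assms(1)] by blast
  have "f = (\<lambda>z. LINT \<xi>|lborel. F \<xi> * exp (2 * pi * \<i> * complex_of_real \<xi> * z))" using f by blast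
  then show ?thesis
    using fourier_extension_holomorphic[OF F(2) F(3)] assms(2) by simp
qed

lemma PW_restr:
  assumes "f \<in> PW B"
  shows "\<exists>F \<in> L2. integrable lborel F \<and> (\<forall>\<xi>. \<bar>\<xi>\<bar> > B \<longrightarrow> F \<xi> = 0) \<and>
    restr f = (\<lambda>t. fourier F (- t)) \<and> restr f \<in> L2"
proof -
  obtain F where F: "F \<in> L2" "integrable lborel F" "\<And>\<xi>. \<bar>\<xi>\<bar> > B \<Longrightarrow> F \<xi> = 0"
    and f: "\<And>z. f z = (LINT \<xi>|lborel. F \<xi> * exp (2 * pi * \<i> * complex_of_real \<xi> * z))"
    using PW_imp_fourier[OF assms] by blast
  have 1: "restr f = (\<lambda>t. fourier F (- t))"
    by (simp add: fun_eq_iff restr_def f fourier_def cis_conv_exp mult_ac)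
  have 2: "restr f \<in> L2"
    unfolding 1 using L2_reflect[OF fourier_L2[OF F(1,2)], of 0] by simp
  show ?thesis using F 1 2 by blast
qed

lemma holomorphic_restr_isCont:
  assumes "f holomorphic_on UNIV" shows "isCont (restr f) t"
proof -
  have "isCont f (complex_of_real t)"
    using holomorphic_on_imp_continuous_on[OF assms] by (simp add: continuous_on_eq_continuous_at)
  then show ?thesis unfolding restr_def 
    by (intro isCont_o2[where f = complex_of_real and g = f]) (auto intro!: continuous_intros)
qed

text \<open>The transforms of the two autocorrelations agree almost everywhere: for
  \<open>\<bar>\<omega>\<bar> > 2 * B\<close> both vanish, and inside the band the nonzero factor
  from \<phi> can be cancelled. Uniqueness for continuous integrable functions then gives equality
  at every \<open>t\<close>.\<close>

lemma PW_autocorrelation_eq: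
  assumes fg: "f \<in> PW B" "g \<in> PW B" and B: "B > 0" and \<phi>: "\<phi> \<in> L2"
    and ne: "AE \<omega> in lborel. \<omega> \<in> {-2*B<..<2*B} \<longrightarrow> ambiguity \<phi> q \<omega> \<noteq> 0"
    and eq: "\<And>x \<omega>. norm (stft \<phi> (restr f) x \<omega>) = norm (stft \<phi> (restr g) x \<omega>)"
  shows "restr f (t + q) * cnj (restr f t) = restr g (t + q) * cnj (restr g t)"
proof -
  obtain F where F: "F \<in> L2" "integrable lborel F" "\<And>\<xi>. \<bar>\<xi>\<bar> > B \<Longrightarrow> F \<xi> = 0"
    "restr f = (\<lambda>t. fourier F (- t))" "restr f \<in> L2"
    using PW_restr[OF fg(1)] by blast
  obtain G where G: "G \<in> L2" "integrable lborel G" "\<And>\<xi>. \<bar>\<xi>\<bar> > B \<Longrightarrow> G \<xi> = 0"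
    "restr g = (\<lambda>t. fourier G (- t))" "restr g \<in> L2"
    using PW_restr[OF fg(2)] by blast
  define w where "w h t = restr h (t + q) * cnj (restr h t)" for h t
  have int: "integrable lborel (w f)" "integrable lborel (w g)"
    unfolding w_def by (intro L2_mult_cnj_integrable L2_translate F(5) G(5))+
  have ft: "fourier (w h) \<omega> = corr (restr h) q \<omega>" for h \<omega>
    by (simp add: w_def fourier_def corr_def)
  have "isCont (w h) x" if "h holomorphic_on UNIV" for h x
    unfolding w_def
    by (intro isCont_mult isCont_cnj holomorphic_restr_isCont that isCont_o2[where f = "\<lambda>t. t + q" and g = "restr h"] isCont_add continuous_ident continuous_const)
  then have cont: "isCont (w f) x" "isCont (w g) x" for x
    using PW_holomorphic[OF fg(1) B] PW_holomorphic[OF fg(2) B] by blast+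
  have diff: "fourier (\<lambda>t. w f t - w g t) \<omega> = corr (restr f) q \<omega> - corr (restr g) q \<omega>" for \<omega>
  proof -
    have "integrable lborel (\<lambda>t. w h t * cis (- (2 * pi * t * \<omega>)))" if "integrable lborel (w h)" for h
      by (rule integrable_mult_bounded[where K = 1, OF that]) auto
    with int show ?thesis unfolding ft[symmetric] by (simp add: fourier_def left_diff_distrib)
  qed
  \<comment> \<open>The points \<open>2 * B\<close> and \<open>- 2 * B\<close> are covered neither
    by the open band of the hypothesis nor by the strict inequality in
    \<open>corr_bandlimited\<close>.\<close>
  have null: "AE \<omega> in lborel. \<omega> \<noteq> 2 * B" "AE \<omega> in lborel. \<omega> \<noteq> - 2 * B"
    by (rule AE_lborel_singleton)+
  have "AE \<omega> in lborel. fourier (\<lambda>t. w f t - w g t) \<omega> = 0"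
    using ne null
  proof eventually_elim
    case (elim \<omega>)
    show ?case
    proof (cases "\<bar>\<omega>\<bar> > 2 * B")
      case True
      then show ?thesis
        using corr_bandlimited[OF F(1-3) True] corr_bandlimited[OF G(1-3) True] by (simp add: diff F(4) G(4))
    next
      case False
      then have "corr \<phi> q \<omega> \<noteq> 0" using elim by (auto simp: ambiguity_def stft_eq_corr)
      then show ?thesis
        using corr_mult_eq_of_norm_stft_eq[OF F(5) G(5) \<phi> eq, of q \<omega>] by (simp add: diff)
    qed
  qed
  moreover have "norm (w f x - w g x) \<le>
      (LINT t|lborel. norm (F t)) * (LINT t|lborel. norm (F t)) + (LINT t|lborel. norm (G t)) * (LINT t|lborel. norm (G t))" for x
  proof -
    have "norm (w f x) \<le> (LINT t|lborel. norm (F t)) * (LINT t|lborel. norm (F t))"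
      "norm (w g x) \<le> (LINT t|lborel. norm (G t)) * (LINT t|lborel. norm (G t))"
      unfolding w_def F(4) G(4) norm_mult complex_mod_cnj
      by (intro mult_mono norm_fourier_le F G; simp)+
    then show ?thesis using norm_triangle_ineq4[of "w f x" "w g x"] by linarith
  qed
  ultimately have "w f t - w g t = 0"
    using int cont by (intro fourier_eq_0_AE_imp[where w = "\<lambda>t. w f t - w g t"] continuous_intros) auto
  then show ?thesis by (simp add: w_def)
qed

text \<open>The spectrum of \<open>f - u g\<close> is tested on the lattice through
  \<open>t\<close>. Since \<open>sampling_zero\<close> expects the lattice through 0, the origin is
  first moved to \<open>t\<close>.\<close>

lemma PW_eq_of_samples:
  assumes fg: "f \<in> PW B" "g \<in> PW B" and B: "B > 0" and c: "c > 0" "c \<le> 1 / (2 * B)"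
    and eq: "\<And>k::int. restr f (t + k * c) = u * restr g (t + k * c)"
  shows "f = (\<lambda>z. u * g z)"
proof (rule ext)
  fix z :: complex
  obtain F where "F \<in> L2" and F: "integrable lborel F" "\<And>\<xi>. \<bar>\<xi>\<bar> > B \<Longrightarrow> F \<xi> = 0"
    "\<And>z. f z = (LINT \<xi>|lborel. F \<xi> * exp (2 * pi * \<i> * complex_of_real \<xi> * z))"
    using PW_imp_fourier[OF fg(1)] by blast
  obtain G where "G \<in> L2" and G: "integrable lborel G" "\<And>\<xi>. \<bar>\<xi>\<bar> > B \<Longrightarrow> G \<xi> = 0"
    "\<And>z. g z = (LINT \<xi>|lborel. G \<xi> * exp (2 * pi * \<i> * complex_of_real \<xi> * z))"
    using PW_imp_fourier[OF fg(2)] by blast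
  \<comment> \<open>Modulating the spectrum by \<open>cis (2 * pi * \<xi> * t)\<close> translates
    the function by \<open>t\<close>, so the exponential at \<open>z - t\<close> returns the value
    at \<open>z\<close>.\<close>
  define H where "H \<xi> = (F \<xi> - u * G \<xi>) * cis (2 * pi * \<xi> * t)" for \<xi>
  have H: "integrable lborel H"
    unfolding H_def by (rule integrable_mult_bounded[where K = 1]) (use F G in auto)
  have ex: "(LINT \<xi>|lborel. H \<xi> * exp (2 * pi * \<i> * complex_of_real \<xi> * (z - t))) = f z - u * g z" for z :: complex
  proof -
    obtain K where K: "norm (exp (2 * pi * \<i> * complex_of_real \<xi> * z)) \<le> K" if "\<bar>\<xi>\<bar> \<le> B" for \<xi>
    proof
      show "norm (exp (2 * pi * \<i> * complex_of_real \<xi> * z)) \<le> exp (2 * pi * B * norm z)" if "\<bar>\<xi>\<bar> \<le> B" for \<xi>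
      proof -
        have "Re (2 * pi * \<i> * complex_of_real \<xi> * z) \<le> norm (2 * pi * \<i> * complex_of_real \<xi> * z)"
          by (rule complex_Re_le_cmod)
        also have "\<dots> \<le> 2 * pi * B * norm z"
          using that B by (auto simp: norm_mult intro!: mult_mono)
        finally show ?thesis by simp
      qed
    qed
    have "integrable lborel (\<lambda>\<xi>. F' \<xi> * exp (2 * pi * \<i> * complex_of_real \<xi> * z))"
      if F': "integrable lborel F'" "\<And>\<xi>. \<bar>\<xi>\<bar> > B \<Longrightarrow> F' \<xi> = 0" for F'
    proof (rule Bochner_Integration.integrable_bound)
      show "integrable lborel (\<lambda>\<xi>. norm (F' \<xi>) * K)" using F' by simp
      show "(\<lambda>\<xi>. F' \<xi> * exp (2 * pi * \<i> * complex_of_real \<xi> * z)) \<in> borel_measurable lborel"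
        using borel_measurable_integrable[OF F'(1)] by measurable
      have "norm (F' \<xi> * exp (2 * pi * \<i> * complex_of_real \<xi> * z)) \<le> norm (F' \<xi>) * K" for \<xi>
        using K[of \<xi>] F'(2)[of \<xi>] by (cases "\<bar>\<xi>\<bar> \<le> B") (auto simp: norm_mult intro!: mult_left_mono simp del: norm_exp_eq_Re)
      from order_trans[OF this abs_ge_self]
      show "AE \<xi> in lborel. norm (F' \<xi> * exp (2 * pi * \<i> * complex_of_real \<xi> * z)) \<le> norm (norm (F' \<xi>) * K)"
        by (intro AE_I2) (simp only: real_norm_def)
    qed
    note i = this[OF F(1,2)] this[OF G(1,2)]
    have "H \<xi> * exp (2 * pi * \<i> * complex_of_real \<xi> * (z - t)) =
        F \<xi> * exp (2 * pi * \<i> * complex_of_real \<xi> * z) - u * (G \<xi> * exp (2 * pi * \<i> * complex_of_real \<xi> * z))" for \<xi>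
    proof -
      have "cis (2 * pi * \<xi> * t) * exp (2 * pi * \<i> * complex_of_real \<xi> * (z - t)) = exp (2 * pi * \<i> * complex_of_real \<xi> * z)"
        unfolding cis_conv_exp exp_add[symmetric] by (rule arg_cong[of _ _ exp]) (simp add: algebra_simps)
      then show ?thesis by (simp add: H_def mult.assoc left_diff_distrib)
    qed
    then show ?thesis using i by (simp add: F(3) G(3))
  qed
  have "(LINT \<xi>|lborel. H \<xi> * cis (2 * pi * c * k * \<xi>)) = 0" for k :: int
  proof -
    have "H \<xi> * cis (2 * pi * c * k * \<xi>) = H \<xi> * exp (2 * pi * \<i> * complex_of_real \<xi> * (complex_of_real (t + k * c) - t))" for \<xi>
      by (simp add: cis_conv_exp mult_ac)
    then have "(LINT \<xi>|lborel. H \<xi> * cis (2 * pi * c * k * \<xi>)) =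
        f (complex_of_real (t + k * c)) - u * g (complex_of_real (t + k * c))"
      by (simp only: ex)
    also have "\<dots> = 0" using eq[of k] by (simp only: restr_def diff_self)
    finally show ?thesis .
  qed
  then have "(LINT \<xi>|lborel. H \<xi> * exp (2 * pi * \<i> * complex_of_real \<xi> * (z - t))) = 0"
    using c B F(2) G(2) by (intro sampling_zero[OF H, of B c]) (auto simp: H_def field_simps)
  then show "f z = u * g z" using ex by simp
qed

theorem theorem3p1:
  fixes B c :: real and \<phi> :: "real \<Rightarrow> complex"
  assumes "B > 0"
    and "c > 0" and "c \<le> 1 / (2 * B)"
    and "\<phi> \<in> L2"
    and "AE \<omega> in lborel. \<omega> \<in> {-2*B<..<2*B} \<longrightarrow> ambiguity \<phi> 0 \<omega> \<noteq> 0"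
    and "AE \<omega> in lborel. \<omega> \<in> {-2*B<..<2*B} \<longrightarrow> ambiguity \<phi> c \<omega> \<noteq> 0"
  shows "\<forall>f \<in> PW B. \<forall>g \<in> PW B.
           (\<exists>\<alpha>::real. f = (\<lambda>z. exp (\<i> * complex_of_real \<alpha>) * g z)) \<longleftrightarrow>
           (\<forall>x \<omega>. norm (stft \<phi> (restr f) x \<omega>) = norm (stft \<phi> (restr g) x \<omega>))"
proof (intro ballI iffI allI)
  fix f g :: "complex \<Rightarrow> complex" and x \<omega>
  assume "\<exists>\<alpha>::real. f = (\<lambda>z. exp (\<i> * complex_of_real \<alpha>) * g z)"
  then obtain \<alpha> :: real where "f = (\<lambda>z. exp (\<i> * complex_of_real \<alpha>) * g z)" by blast
  then have "stft \<phi> (restr f) x \<omega> = exp (\<i> * complex_of_real \<alpha>) * stft \<phi> (restr g) x \<omega>"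
    by (simp add: stft_def restr_def mult.assoc)
  then show "norm (stft \<phi> (restr f) x \<omega>) = norm (stft \<phi> (restr g) x \<omega>)"
    by (simp add: norm_mult)
next
  fix f g :: "complex \<Rightarrow> complex"
  assume fg: "f \<in> PW B" "g \<in> PW B"
    and "\<forall>x \<omega>. norm (stft \<phi> (restr f) x \<omega>) = norm (stft \<phi> (restr g) x \<omega>)"
  then have eq: "norm (stft \<phi> (restr f) x \<omega>) = norm (stft \<phi> (restr g) x \<omega>)" for x \<omega> by blast
  note autocorr = PW_autocorrelation_eq[OF fg assms(1,4) _ eq]
  have modulus: "norm (restr f t) = norm (restr g t)" for t
  proof -
    have "(norm (restr f t))\<^sup>2 = (norm (restr g t))\<^sup>2"
      using autocorr[OF assms(5), of t]
      by (simp add: of_real_eq_iff[where 'a = complex, symmetric] complex_norm_square del: of_real_eq_iff of_real_power)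
    then show ?thesis by simp
  qed
  have shift: "restr f (t + c) * cnj (restr f t) = restr g (t + c) * cnj (restr g t)" for t
    by (rule autocorr[OF assms(6)])
  have fh: "f holomorphic_on UNIV" and gh: "g holomorphic_on UNIV"
    by (rule PW_holomorphic[OF _ assms(1)], rule fg)+
  show "\<exists>\<alpha>::real. f = (\<lambda>z. exp (\<i> * complex_of_real \<alpha>) * g z)"
  proof (cases "countable {t. restr g t = 0}")
    \<comment> \<open>Equal moduli give \<open>f\<close> and \<open>g\<close> the same real zeros.
      An entire function with uncountably many zeros vanishes identically, so here both are 0 and
      any \<alpha> serves.\<close>
    case False
    moreover have "{t. restr f t = 0} = {t. restr g t = 0}"
      using modulus by (metis norm_eq_zero)
    ultimately have "f = (\<lambda>_. 0)" "g = (\<lambda>_. 0)"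
      using False entire_real_zeros_countable[OF fh] entire_real_zeros_countable[OF gh] by (auto simp: restr_def)
    then show ?thesis by simp
  next
    case True
    \<comment> \<open>The bad offsets, for which some point of the lattice through \<open>t\<close>
      is a zero of \<open>g\<close>: a countable union of translates of a countable set.\<close>
    let ?Z = "\<Union>k::int. (\<lambda>t. t - k * c) ` {t. restr g t = 0}"
    have "countable ?Z" using True by simp
    then obtain t where t: "t \<notin> ?Z"
      using uncountable_UNIV_real by (metis UNIV_eq_I)
    have ne: "restr g (t + k * c) \<noteq> 0" for k :: int
      using t by (auto simp: image_iff) (metis add_diff_cancel_right')
    define u where "u = restr f t / restr g t"
    have "norm u = 1"
      using modulus[of t] ne[of 0] by (simp add: u_def norm_divide)
    then have uu: "u * cnj u = 1" by (simp add: complex_norm_square[symmetric])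
    \<comment> \<open>The quotient \<open>u\<close> at the base point is carried along the lattice
      by \<open>shift\<close>. Going up, the conjugate of \<open>g\<close> at the known point is
      cancelled; going down, \<open>g\<close> itself at that point. Both cancellations rest on
      \<open>ne\<close>, and \<open>uu\<close> inverts \<open>u\<close>.\<close>
    have samples: "restr f (t + k * c) = u * restr g (t + k * c)" for k :: int
    proof (induction k rule: int_induct[where k = 0])
      case base
      then show ?case using ne[of 0] by (simp add: u_def)
    next
      case (step1 k)
      have "t + real_of_int (k + 1) * c = t + real_of_int k * c + c" by (simp add: algebra_simps)
      note next_eq = this
      have "restr f (t + (k + 1) * c) * cnj u * cnj (restr g (t + k * c)) = restr g (t + (k + 1) * c) * cnj (restr g (t + k * c))"
        using shift[of "t + k * c"] unfolding next_eq step1(2) complex_cnj_mult by (simp only: mult_ac)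
      then have "restr f (t + (k + 1) * c) * cnj u = restr g (t + (k + 1) * c)"
        using ne[of k] by simp
      then have "u * restr g (t + (k + 1) * c) = restr f (t + (k + 1) * c) * (u * cnj u)" by (simp add: mult_ac)
      then show ?case by (simp add: uu)
    next
      case (step2 k)
      have "t + real_of_int k * c = t + real_of_int (k - 1) * c + c" by (simp add: algebra_simps)
      note next_eq = this
      have "restr g (t + k * c) * (u * cnj (restr f (t + (k - 1) * c))) = restr g (t + k * c) * cnj (restr g (t + (k - 1) * c))"
        using shift[of "t + (k - 1) * c"] unfolding next_eq[symmetric] step2(2) by (simp only: mult_ac)
      then have "u * cnj (restr f (t + (k - 1) * c)) = cnj (restr g (t + (k - 1) * c))"
        using ne[of k] by simp
      then have "cnj (u * cnj (restr f (t + (k - 1) * c))) = restr g (t + (k - 1) * c)" by simp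
      then have "u * restr g (t + (k - 1) * c) = u * cnj u * restr f (t + (k - 1) * c)" by (simp add: mult_ac)
      then show ?case by (simp add: uu)
    qed
    have "u = exp (\<i> * complex_of_real (Arg u))"
      using Arg_eq[of u] \<open>norm u = 1\<close> by (cases "u = 0") simp_all
    then show ?thesis
      using PW_eq_of_samples[OF fg assms(1-3) samples] by metis
  qed
qed

end
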